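(* Let $X$ be a non-empty topological space. The following are equivalent: (a) $X$ is a ray space. (b) Alice has a winning strategy in $\mathrm{RayGame}(X)$.
   Context: Trees. A tree is a partially ordered set $(T,\le)$ with a minimum (its root) such that $\lceil t\rceil=\{s\in T:s\le t\}$ is well-ordered for every $t\in T$. A ray of $T$ is a non-empty downward closed chain of $T$ with no maximal element; $\mathcal R(T)$ is the set of all rays with the subspace topology inherited from the power set $\mathcal P(T)\simeq2^T$ (product topology). A space is a ray space if it is homeomorphic to $\mathcal R(T)$ for some tree $T$. The game. A partition of a set is a pairwise disjoint collection of non-empty sets whose union is that set; an open partition is one whose members are open. For a non-empty space $X$, $\mathrm{RayGame}(X)$ is a transfinite game between Alice and Bob. In inning $0$, Alice chooses an open partition $\mathcal P_0$ of $X$ and Bob picks $U_0\in\mathcal P_0$. In a successor inning $\alpha=\beta+1$, Alice chooses an open partition $\mathcal P_{\beta+1}$ of $U_\beta$ and Bob picks $U_{\beta+1}\in\mathcal P_{\beta+1}$. In a (nonzero) limit inning $\alpha$: if there exist a pairwise disjoint collection $\mathcal P_\alpha$ of non-empty open sets and a point $x_\alpha\in X$ such that (1) $\bigcap_{\beta<\alpha}U_\beta=(\bigcup\mathcal P_\alpha)\sqcup\{x_\alpha\}$ (disjoint union) and (2) $\{U_\beta\setminus\bigcup\mathcal F:\beta<\alpha,\ \mathcal F\subset\mathcal P_\alpha\text{ finite}\}$ is a local basis at $x_\alpha$, then Alice chooses one such pair $(\mathcal P_\alpha,x_\alpha)$; if $\mathcal P_\alpha\ne\emptyset$, Bob picks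 $U_\alpha\in\mathcal P_\alpha$ and the game continues, while if $\mathcal P_\alpha=\emptyset$ the run ends and Alice wins. If no such pair exists, the run ends and Bob wins. A strategy for Alice is a map assigning to each sequence $(U_\beta:\beta<\alpha)$ of Bob's moves made against it so far a legal move of Alice in inning $\alpha$ whenever she has one; it is winning if every finished run in which Alice follows it is won by Alice. *)

theory Defs
  imports "HOL-Analysis.Analysis" "HOL-Library.Disjoint_Sets"
begin

section \<open>Trees and ray spaces\<close>

definition tree_on :: "'b set \<Rightarrow> 'b rel \<Rightarrow> bool" where
  "tree_on T r \<longleftrightarrow>
     partial_order_on T r \<and>
     (\<exists>root\<in>T. \<forall>t\<in>T. (root, t) \<in> r) \<and>
     (\<forall>t\<in>T. well_order_on (under r t) (Restr r (under r t)))"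

definition rays :: "'b set \<Rightarrow> 'b rel \<Rightarrow> 'b set set" where
  "rays T r =
     {R. R \<noteq> {} \<and> R \<subseteq> T \<and> R \<in> Chains r \<and>
         (\<forall>t\<in>R. \<forall>s\<in>T. (s, t) \<in> r \<longrightarrow> s \<in> R) \<and>
         \<not> (\<exists>m\<in>R. \<forall>t\<in>R. (m, t) \<in> r \<longrightarrow> t = m)}"

text \<open>The topology on the power set of \<open>T\<close> that makes the bijection sending a subset
  to its characteristic function a homeomorphism onto the product \<open>2\<^sup>T\<close> of discrete
  two-point spaces.\<close>

definition Pow_topology :: "'b set \<Rightarrow> 'b set topology" where
  "Pow_topology T =
     pullback_topology (Pow T) (\<lambda>S. restrict (\<lambda>t. t \<in> S) T)
       (product_topology (\<lambda>_. discrete_topology (UNIV :: bool set)) T)"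

definition rays_topology :: "'b set \<Rightarrow> 'b rel \<Rightarrow> 'b set topology" where
  "rays_topology T r = subtopology (Pow_topology T) (rays T r)"

text \<open>A definition cannot quantify over types, so the type \<open>'b\<close> that the nodes of the
  tree are taken from is a parameter.  A tree on any type whose space of rays is \<open>X\<close> can be
  replaced by one on \<open>'a set \<times> 'a inning\<close> (\<open>inning\<close> is defined below): in the tree of
  Bob's moves against a fixed strategy, a node is determined by the move and its inning.\<close>

definition ray_space :: "'b itself \<Rightarrow> 'a topology \<Rightarrow> bool" where
  "ray_space node_type X \<longleftrightarrow>
     (\<exists>(T :: 'b set) r. tree_on T r \<and> X homeomorphic_space rays_topology T r)"

section \<open>Innings\<close>

text \<open>The innings are the ordinals below the successor cardinal of \<open>max \<bar>'a\<bar> \<aleph>\<^sub>0\<close>, where \<open>'a\<close>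
  is the type of the points of the space.  This is no restriction on the length of the
  game: every limit inning that is survived discards a point of the space, so that no run
  gets through all of these innings (lemma \<open>every_run_ends\<close> below).\<close>

lemma Card_order_innings: "Card_order (cardSuc (card_of (UNIV :: ('a + nat) set)))"
  by (rule cardSuc_Card_order[OF card_of_Card_order])

lemma innings_greater:
  "(card_of (UNIV :: ('a + nat) set), card_of (Field (cardSuc (card_of (UNIV :: ('a + nat) set))))) \<in> ordLess"
  using cardSuc_greater[OF card_of_Card_order] Card_order_innings
  by (meson card_of_Field_ordIso ordIso_symmetric ordLess_ordIso_trans)

typedef 'a inning = "Field (cardSuc (card_of (UNIV :: ('a + nat) set)))"
proof -
  have "Field (cardSuc (card_of (UNIV :: ('a + nat) set))) \<noteq> {}"
  proof
    assume "Field (cardSuc (card_of (UNIV :: ('a + nat) set))) = {}"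
    with innings_greater[where 'a = 'a]
    have "(card_of (UNIV :: ('a + nat) set), card_of ({} :: ('a + nat) set set)) \<in> ordLess"
      by simp
    then show False
      by (meson card_of_empty not_ordLess_ordLeq)
  qed
  then show ?thesis by blast
qed

instantiation inning :: (type) wellorder
begin

definition less_eq_inning :: "'a inning \<Rightarrow> 'a inning \<Rightarrow> bool" where
  "\<alpha> \<le> \<beta> \<longleftrightarrow> (Rep_inning \<alpha>, Rep_inning \<beta>) \<in> cardSuc (card_of (UNIV :: ('a + nat) set))"

definition less_inning :: "'a inning \<Rightarrow> 'a inning \<Rightarrow> bool" where
  "(\<alpha> :: 'a inning) < \<beta> \<longleftrightarrow> \<alpha> \<le> \<beta> \<and> \<alpha> \<noteq> \<beta>"

instance
proof -
  let ?r = "cardSuc (card_of (UNIV :: ('a + nat) set))"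
  have wo: "Well_order ?r"
    using Card_order_innings[where 'a = 'a] by (simp add: card_order_on_def)
  then have "Refl ?r" and tr: "trans ?r" and as: "antisym ?r" and tot: "Total ?r" and wf: "wf (?r - Id)"
    by (auto simp: order_on_defs)
  have refl: "(Rep_inning \<alpha>, Rep_inning \<alpha>) \<in> ?r" for \<alpha> :: "'a inning"
    using \<open>Refl ?r\<close> Rep_inning[of \<alpha>] by (auto simp: refl_on_def)
  show "OFCLASS('a inning, wellorder_class)"
  proof
    fix x y z :: "'a inning"
    show anti: "x = y" if "x \<le> y" "y \<le> x" for x y :: "'a inning"
      using that as by (auto simp: less_eq_inning_def intro: Rep_inning_inject[THEN iffD1] dest: antisymD)
    show "x < y \<longleftrightarrow> x \<le> y \<and> \<not> y \<le> x"
      using anti[of x y] refl by (auto simp: less_inning_def less_eq_inning_def)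
    show "x \<le> x"
      using refl by (simp add: less_eq_inning_def)
    show "x \<le> z" if "x \<le> y" "y \<le> z"
      using that tr by (auto simp: less_eq_inning_def trans_def)
    show "x \<le> y \<or> y \<le> x"
      using tot refl Rep_inning[of x] Rep_inning[of y]
      by (cases "x = y") (auto simp: less_eq_inning_def total_on_def Rep_inning_inject)
  next
    fix P :: "'a inning \<Rightarrow> bool" and a
    assume step: "\<And>x. (\<And>y. y < x \<Longrightarrow> P y) \<Longrightarrow> P x"
    have "wf (inv_image (?r - Id) (Rep_inning :: 'a inning \<Rightarrow> _))"
      using wf by (rule wf_inv_image)
    moreover have "(y, x) \<in> inv_image (?r - Id) Rep_inning \<longleftrightarrow> y < x" for x y :: "'a inning"
      by (auto simp: inv_image_def less_inning_def less_eq_inning_def Rep_inning_inject)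
    ultimately show "P a"
      using step by (induction a rule: wf_induct_rule) blast
  qed
qed

end

definition first_inning :: "'a inning \<Rightarrow> bool" where
  "first_inning \<alpha> \<longleftrightarrow> (\<forall>\<beta>. \<alpha> \<le> \<beta>)"

definition next_inning :: "'a inning \<Rightarrow> 'a inning \<Rightarrow> bool" where
  "next_inning \<beta> \<alpha> \<longleftrightarrow> \<beta> < \<alpha> \<and> (\<forall>\<gamma><\<alpha>. \<gamma> \<le> \<beta>)"

definition limit_inning :: "'a inning \<Rightarrow> bool" where
  "limit_inning \<alpha> \<longleftrightarrow> \<not> first_inning \<alpha> \<and> (\<nexists>\<beta>. next_inning \<beta> \<alpha>)"

section \<open>The game\<close>

definition open_partition :: "'a topology \<Rightarrow> 'a set \<Rightarrow> 'a set set \<Rightarrow> bool" where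
  "open_partition X A P \<longleftrightarrow> partition_on A P \<and> (\<forall>V\<in>P. openin X V)"

definition local_basis :: "'a topology \<Rightarrow> 'a \<Rightarrow> 'a set set \<Rightarrow> bool" where
  "local_basis X x \<B> \<longleftrightarrow>
     (\<forall>B\<in>\<B>. openin X B \<and> x \<in> B) \<and>
     (\<forall>W. openin X W \<and> x \<in> W \<longrightarrow> (\<exists>B\<in>\<B>. B \<subseteq> W))"

text \<open>\<open>Partition P\<close> is a move of Alice in inning zero or in a successor inning,
  \<open>Limit P x\<close> one in a limit inning.\<close>

datatype 'a move = Partition (pieces: "'a set set") | Limit (pieces: "'a set set") 'a

text \<open>Here and below, a sequence \<open>(U\<^sub>\<beta> : \<beta> < \<alpha>)\<close> is the restriction of a function
  \<open>U\<close> to \<open>{..<\<alpha>}\<close>; the values of \<open>U\<close> elsewhere are irrelevant.\<close>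

definition legal :: "'a topology \<Rightarrow> 'a inning \<Rightarrow> ('a inning \<Rightarrow> 'a set) \<Rightarrow> 'a move \<Rightarrow> bool" where
  "legal X \<alpha> U m \<longleftrightarrow>
     (case m of
        Partition P \<Rightarrow>
          first_inning \<alpha> \<and> open_partition X (topspace X) P \<or>
          (\<exists>\<beta>. next_inning \<beta> \<alpha> \<and> open_partition X (U \<beta>) P)
      | Limit P x \<Rightarrow>
          limit_inning \<alpha> \<and>
          disjoint P \<and> (\<forall>V\<in>P. openin X V \<and> V \<noteq> {}) \<and> x \<in> topspace X \<and>
          (\<Inter>\<beta>\<in>{..<\<alpha>}. U \<beta>) = \<Union>P \<union> {x} \<and> x \<notin> \<Union>P \<and>
          local_basis X x {U \<beta> - \<Union>\<F> |\<beta> \<F>. \<beta> < \<alpha> \<and> \<F> \<subseteq> P \<and> finite \<F>})"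

text \<open>\<open>A\<close> and \<open>U\<close> are the moves of Alice and of Bob; all innings before \<open>\<alpha>\<close> have been
  played completely.\<close>

definition played ::
    "'a topology \<Rightarrow> 'a inning \<Rightarrow> ('a inning \<Rightarrow> 'a move) \<Rightarrow> ('a inning \<Rightarrow> 'a set) \<Rightarrow> bool" where
  "played X \<alpha> A U \<longleftrightarrow> (\<forall>\<beta><\<alpha>. legal X \<beta> U (A \<beta>) \<and> U \<beta> \<in> pieces (A \<beta>))"

text \<open>A run that ends in inning \<open>\<alpha>\<close>; in \<open>won_by_Alice\<close>, \<open>A \<alpha>\<close> is Alice's last move.\<close>

definition won_by_Alice ::
    "'a topology \<Rightarrow> 'a inning \<Rightarrow> ('a inning \<Rightarrow> 'a move) \<Rightarrow> ('a inning \<Rightarrow> 'a set) \<Rightarrow> bool" where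
  "won_by_Alice X \<alpha> A U \<longleftrightarrow>
     played X \<alpha> A U \<and> limit_inning \<alpha> \<and> legal X \<alpha> U (A \<alpha>) \<and> pieces (A \<alpha>) = {}"

definition won_by_Bob ::
    "'a topology \<Rightarrow> 'a inning \<Rightarrow> ('a inning \<Rightarrow> 'a move) \<Rightarrow> ('a inning \<Rightarrow> 'a set) \<Rightarrow> bool" where
  "won_by_Bob X \<alpha> A U \<longleftrightarrow>
     played X \<alpha> A U \<and> limit_inning \<alpha> \<and> (\<nexists>m. legal X \<alpha> U m)"

definition finished_run ::
    "'a topology \<Rightarrow> 'a inning \<Rightarrow> ('a inning \<Rightarrow> 'a move) \<Rightarrow> ('a inning \<Rightarrow> 'a set) \<Rightarrow> bool" where
  "finished_run X \<alpha> A U \<longleftrightarrow> won_by_Alice X \<alpha> A U \<or> won_by_Bob X \<alpha> A U"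

text \<open>A strategy takes the length \<open>\<alpha>\<close> of a sequence and the sequence itself, as a function
  that is undefined outside \<open>{..<\<alpha>}\<close>.\<close>

type_synonym 'a strategy = "'a inning \<Rightarrow> ('a inning \<Rightarrow> 'a set) \<Rightarrow> 'a move"

definition answers :: "'a strategy \<Rightarrow> ('a inning \<Rightarrow> 'a set) \<Rightarrow> 'a inning \<Rightarrow> 'a move" where
  "answers \<sigma> U \<alpha> = \<sigma> \<alpha> (restrict U {..<\<alpha>})"

definition Alice_strategy :: "'a topology \<Rightarrow> 'a strategy \<Rightarrow> bool" where
  "Alice_strategy X \<sigma> \<longleftrightarrow>
     (\<forall>\<alpha> U. played X \<alpha> (answers \<sigma> U) U \<and> (\<exists>m. legal X \<alpha> U m) \<longrightarrow> legal X \<alpha> U (answers \<sigma> U \<alpha>))"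

definition Alice_winning_strategy :: "'a topology \<Rightarrow> 'a strategy \<Rightarrow> bool" where
  "Alice_winning_strategy X \<sigma> \<longleftrightarrow>
     Alice_strategy X \<sigma> \<and>
     (\<forall>\<alpha> U. finished_run X \<alpha> (answers \<sigma> U) U \<longrightarrow> won_by_Alice X \<alpha> (answers \<sigma> U) U)"

lemma every_run_ends: "\<exists>\<alpha>. \<not> played X \<alpha> A U"
proof (rule ccontr)
  assume "\<nexists>\<alpha>. \<not> played X \<alpha> A U"
  then have all: "played X \<alpha> A U" for \<alpha> by blast
  define L :: "'a inning set" where "L = {\<alpha>. limit_inning \<alpha>}"
  define zero :: "'a inning" where "zero = (LEAST \<alpha>. True)"
  have zero: "\<alpha> = zero" if "first_inning \<alpha>" for \<alpha>
    using that unfolding zero_def first_inning_def by (metis (mono_tags) Least_equality)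
  define nxt :: "'a inning \<Rightarrow> 'a inning" where "nxt \<beta> = (LEAST \<gamma>. \<beta> < \<gamma>)" for \<beta>
  have nxt: "nxt \<beta> = \<alpha>" if "next_inning \<beta> \<alpha>" for \<alpha> \<beta>
    using that unfolding nxt_def next_inning_def by (metis Least_equality leD leI)
  have gen: "\<exists>\<beta> n. \<beta> \<in> insert zero L \<and> \<alpha> = (nxt ^^ n) \<beta>" for \<alpha>
  proof (induction \<alpha> rule: less_induct)
    case (less \<alpha>)
    consider "first_inning \<alpha>" | "limit_inning \<alpha>" | \<beta> where "next_inning \<beta> \<alpha>"
      unfolding limit_inning_def by blast
    then show ?case
    proof cases
      case 1
      then show ?thesis using zero by (metis funpow_0 insertI1)
    next
      case 2
      then show ?thesis unfolding L_def by (metis funpow_0 insertI2 mem_Collect_eq)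
    next
      case 3
      then have "\<beta> < \<alpha>" by (simp add: next_inning_def)
      from less[OF this] obtain \<gamma> n where "\<gamma> \<in> insert zero L" "\<beta> = (nxt ^^ n) \<gamma>" by blast
      moreover have "\<alpha> = (nxt ^^ Suc n) \<gamma>" using nxt[OF 3] calculation by simp
      ultimately show ?thesis by blast
    qed
  qed
  have "\<exists>x. x \<in> (\<Inter>\<beta>\<in>{..<\<alpha>}. U \<beta>) \<and> x \<notin> U \<alpha>" if "limit_inning \<alpha>" for \<alpha>
  proof -
    have succ: "\<alpha> < nxt \<alpha>"
    proof (rule ccontr)
      assume no: "\<not> \<alpha> < nxt \<alpha>"
      have max: "\<gamma> \<le> \<alpha>" for \<gamma>
      proof (rule ccontr)
        assume "\<not> \<gamma> \<le> \<alpha>"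
        then have "\<alpha> < \<gamma>" by simp
        then have "\<alpha> < nxt \<alpha>" unfolding nxt_def by (rule LeastI)
        with no show False by simp
      qed
      let ?r = "cardSuc (card_of (UNIV :: ('a + nat) set))"
      have inf: "\<not> finite (Field ?r)"
        using innings_greater[where 'a = 'a]
        by (metis card_of_ordLeq_finite finite_Plus_UNIV_iff infinite_UNIV_nat ordLess_imp_ordLeq)
      have ro: "Card_order ?r" by (rule Card_order_innings)
      have "Rep_inning \<alpha> \<in> Field ?r" by (rule Rep_inning)
      then obtain b where "b \<in> Field ?r" "b \<noteq> Rep_inning \<alpha>" "(Rep_inning \<alpha>, b) \<in> ?r"
        using infinite_Card_order_limit[OF ro inf] by metis
      then have "\<alpha> \<le> Abs_inning b" "Abs_inning b \<noteq> \<alpha>"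
        by (auto simp: less_eq_inning_def Abs_inning_inverse)
      with max[of "Abs_inning b"] show False by simp
    qed
    have "legal X \<alpha> U (A \<alpha>)" "U \<alpha> \<in> pieces (A \<alpha>)"
      using all[of "nxt \<alpha>"] succ by (auto simp: played_def)
    moreover have "\<not> first_inning \<alpha>" "\<nexists>\<beta>. next_inning \<beta> \<alpha>"
      using that by (auto simp: limit_inning_def)
    ultimately show ?thesis
      by (cases "A \<alpha>") (auto simp: legal_def)
  qed
  then obtain p where p: "\<And>\<alpha>. limit_inning \<alpha> \<Longrightarrow> p \<alpha> \<in> (\<Inter>\<beta>\<in>{..<\<alpha>}. U \<beta>) \<and> p \<alpha> \<notin> U \<alpha>"
    by metis
  have "inj_on p L"
  proof (rule inj_onI)
    fix \<alpha> \<beta> assume "\<alpha> \<in> L" "\<beta> \<in> L" "p \<alpha> = p \<beta>"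
    then show "\<alpha> = \<beta>"
      using p[of \<alpha>] p[of \<beta>] unfolding L_def by (cases \<alpha> \<beta> rule: linorder_cases) auto
  qed
  define h where "h = (\<lambda>z :: ('a + nat) \<times> ('a + nat). case z of
      (Inl x, Inr n) \<Rightarrow> (nxt ^^ n) (inv_into L p x) | (_, Inr n) \<Rightarrow> (nxt ^^ n) zero | _ \<Rightarrow> zero)"
  have "\<alpha> \<in> range h" for \<alpha>
  proof -
    obtain \<beta> n where b: "\<beta> \<in> insert zero L" "\<alpha> = (nxt ^^ n) \<beta>" using gen by blast
    show ?thesis
    proof (cases "\<beta> \<in> L")
      case True
      then have "h (Inl (p \<beta>), Inr n) = \<alpha>"
        using b \<open>inj_on p L\<close> by (simp add: h_def)
      then show ?thesis by blast
    next
      case False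
      then have "h (Inr 0, Inr n) = \<alpha>" using b by (simp add: h_def)
      then show ?thesis by blast
    qed
  qed
  then have "range (Rep_inning \<circ> h) = Field (cardSuc (card_of (UNIV :: ('a + nat) set)))"
    by (metis image_comp Rep_inning Rep_inning_cases UNIV_I UNIV_eq_I
        type_definition.Rep_range type_definition_inning)
  then have "(card_of (Field (cardSuc (card_of (UNIV :: ('a + nat) set)))),
      card_of (UNIV :: (('a + nat) \<times> ('a + nat)) set)) \<in> ordLeq"
    by (metis card_of_image)
  moreover have "(card_of (UNIV :: (('a + nat) \<times> ('a + nat)) set),
      card_of (UNIV :: ('a + nat) set)) \<in> ordIso"
    using card_of_Times_same_infinite[of "UNIV :: ('a + nat) set"] by simp
  ultimately show False
    using innings_greater[where 'a = 'a]
    by (meson not_ordLess_ordLeq ordLeq_ordIso_trans)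
qed

end

(* A node t of a tree corresponds to the clopen set of the points whose ray contains t. Given a tree, Alice always answers with the nodes that are minimal above
   the nodes common to all points of the current position; at a limit inning these common nodes
   form a ray, hence a point, and the finitely many nodes that a basic neighbourhood of it excludes
   are handled by removing finitely many of her pieces. Conversely, against a fixed winning strategy
   every point x determines the run in which Bob always picks the piece containing x. This run
   lasts until the limit inning in which Alice discards x, and Bob's moves, tagged with
   their innings, are the nodes of a tree whose rays are the points of X. *)
theory Submission
  imports Defs
begin

section \<open>The topology of a ray space\<close>

text \<open>Two facts carry the passage from a strategy to a tree. Alice's answers depend only on
  Bob's earlier moves and her pieces are disjoint, so a run is recovered from any point that lies in
  all its moves. And a winning strategy never lacks a legal answer: a ray of the tree of moves is a
  run whose length is a limit inning, and the answer there names the point to which the ray belongs.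
  This yields surjectivity. The innings are attached to the moves because a trivial partition
  repeats a set. On a one-point space every move is the same set; without the innings the tree would
  have a single node and no ray. The rules make Bob's moves open but do not mention that they are
  closed. This is extracted from the local bases at discarded points, and it is what makes the
  topology of the rays no finer than that of \<open>X\<close>.\<close>

lemma openin_Pow_topology:
  "openin (Pow_topology T) V \<longleftrightarrow>
     V \<subseteq> Pow T \<and> (\<forall>S\<in>V. \<exists>F. finite F \<and> F \<subseteq> T \<and> (\<forall>Q\<subseteq>T. (\<forall>t\<in>F. t \<in> Q \<longleftrightarrow> t \<in> S) \<longrightarrow> Q \<in> V))"
  (is "?l \<longleftrightarrow> ?r")
proof
  let ?P = "product_topology (\<lambda>_. discrete_topology (UNIV :: bool set)) T"
  assume ?l
  then obtain U where U: "openin ?P U" "V = (\<lambda>S. restrict (\<lambda>t. t \<in> S) T) -` U \<inter> Pow T"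
    by (auto simp: Pow_topology_def openin_pullback_topology)
  show ?r
  proof (intro conjI ballI)
    show "V \<subseteq> Pow T" using U by blast
    fix S assume "S \<in> V"
    then have "restrict (\<lambda>t. t \<in> S) T \<in> U" using U by blast
    \<comment> \<open>The coordinates restricted by a basic box around the characteristic function
      of \<open>S\<close> form the required finite set.\<close>
    then obtain B where B: "finite {t \<in> T. B t \<noteq> UNIV}" "restrict (\<lambda>t. t \<in> S) T \<in> Pi\<^sub>E T B" "Pi\<^sub>E T B \<subseteq> U"
      using U(1) unfolding openin_product_topology_alt by fastforce
    have "Q \<in> V" if "Q \<subseteq> T" "\<forall>t\<in>{t \<in> T. B t \<noteq> UNIV}. t \<in> Q \<longleftrightarrow> t \<in> S" for Q
    proof -
      have "(t \<in> Q) \<in> B t" if "t \<in> T" for t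
        using B(2) that \<open>\<forall>t\<in>_. _\<close> by (cases "B t = UNIV") (auto simp: PiE_iff)
      then have "restrict (\<lambda>t. t \<in> Q) T \<in> Pi\<^sub>E T B" by auto
      then have "restrict (\<lambda>t. t \<in> Q) T \<in> U" using B(3) by blast
      then show ?thesis using U(2) that(1) by blast
    qed
    then show "\<exists>F. finite F \<and> F \<subseteq> T \<and> (\<forall>Q\<subseteq>T. (\<forall>t\<in>F. t \<in> Q \<longleftrightarrow> t \<in> S) \<longrightarrow> Q \<in> V)"
      using B(1) by (intro exI[of _ "{t \<in> T. B t \<noteq> UNIV}"]) auto
  qed
next
  let ?P = "product_topology (\<lambda>_. discrete_topology (UNIV :: bool set)) T"
  assume r: ?r
  \<comment> \<open>\<open>V\<close> as a set of characteristic functions. The points of the product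
    are extensional, so a function is determined by the subset of \<open>T\<close> on which it is
    true.\<close>
  define U where "U = {p \<in> extensional T. {t \<in> T. p t} \<in> V}"
  have "openin ?P U"
    unfolding openin_product_topology_alt
  proof
    fix p assume "p \<in> U"
    then have p: "p \<in> extensional T" "{t \<in> T. p t} \<in> V" by (auto simp: U_def)
    then obtain F where F: "finite F" "F \<subseteq> T"
      "\<And>Q. Q \<subseteq> T \<Longrightarrow> \<forall>t\<in>F. t \<in> Q \<longleftrightarrow> t \<in> {t \<in> T. p t} \<Longrightarrow> Q \<in> V"
      using r by meson
    define B where "B t = (if t \<in> F then {p t} else UNIV)" for t
    have "{t \<in> T. B t \<noteq> UNIV} \<subseteq> F" by (auto simp: B_def)
    then have "finite {t \<in> T. B t \<noteq> UNIV}" using F(1) finite_subset by blast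
    moreover have "p \<in> Pi\<^sub>E T B" using p by (auto simp: PiE_iff B_def)
    moreover have "Pi\<^sub>E T B \<subseteq> U"
    proof
      fix q assume q: "q \<in> Pi\<^sub>E T B"
      then have "q t = p t" if "t \<in> F" for t
        using F(2) that by (auto simp: PiE_iff B_def split: if_splits)
      then have "{t \<in> T. q t} \<in> V" using F(2) by (intro F(3)) auto
      then show "q \<in> U" using q by (auto simp: U_def PiE_iff)
    qed
    ultimately show "\<exists>B. finite {t \<in> T. B t \<noteq> topspace (discrete_topology (UNIV :: bool set))} \<and>
        (\<forall>t\<in>T. openin (discrete_topology UNIV) (B t)) \<and> p \<in> Pi\<^sub>E T B \<and> Pi\<^sub>E T B \<subseteq> U"
      by (intro exI[of _ B]) auto
  qed
  moreover have "V = (\<lambda>S. restrict (\<lambda>t. t \<in> S) T) -` U \<inter> Pow T"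
  proof -
    have "{t \<in> T. t \<in> S} = S" if "S \<subseteq> T" for S using that by auto
    then have "restrict (\<lambda>t. t \<in> S) T \<in> U \<longleftrightarrow> S \<in> V" if "S \<subseteq> T" for S
      using that by (auto simp: U_def cong: conj_cong)
    then show ?thesis using r by auto
  qed
  ultimately show ?l
    unfolding Pow_topology_def openin_pullback_topology by blast
qed

lemma topspace_rays_topology: "topspace (rays_topology T r) = rays T r"
proof -
  have "openin (Pow_topology T) (Pow T)"
    unfolding openin_Pow_topology by (auto intro: exI[of _ "{}"])
  then have "Pow T \<subseteq> topspace (Pow_topology T)" by (rule openin_subset)
  moreover have "rays T r \<subseteq> Pow T" by (auto simp: rays_def)
  ultimately show ?thesis by (auto simp: rays_topology_def)
qed

lemma openin_rays_topology:
  "openin (rays_topology T r) V \<longleftrightarrow>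
     V \<subseteq> rays T r \<and>
     (\<forall>R\<in>V. \<exists>F. finite F \<and> F \<subseteq> T \<and> {Q \<in> rays T r. \<forall>t\<in>F. t \<in> Q \<longleftrightarrow> t \<in> R} \<subseteq> V)"
  (is "?l \<longleftrightarrow> ?r")
proof
  assume ?l
  then obtain U where U: "openin (Pow_topology T) U" "V = U \<inter> rays T r"
    by (auto simp: rays_topology_def openin_subtopology)
  show ?r
  proof (intro conjI ballI)
    show "V \<subseteq> rays T r" using U by blast
    fix R assume "R \<in> V"
    then obtain F where "finite F" "F \<subseteq> T" "\<And>Q. Q \<subseteq> T \<Longrightarrow> \<forall>t\<in>F. t \<in> Q \<longleftrightarrow> t \<in> R \<Longrightarrow> Q \<in> U"
      using U unfolding openin_Pow_topology by (metis IntD1)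
    then show "\<exists>F. finite F \<and> F \<subseteq> T \<and> {Q \<in> rays T r. \<forall>t\<in>F. t \<in> Q \<longleftrightarrow> t \<in> R} \<subseteq> V"
      using U(2) by (intro exI[of _ F]) (auto simp: rays_def)
  qed
next
  assume r: ?r
  \<comment> \<open>The union of all basic open sets of the power set whose trace on the rays lies
    in \<open>V\<close>; it may well contain sets that are not rays.\<close>
  define U where "U = {S. S \<subseteq> T \<and> (\<exists>F. finite F \<and> F \<subseteq> T \<and> {Q \<in> rays T r. \<forall>t\<in>F. t \<in> Q \<longleftrightarrow> t \<in> S} \<subseteq> V)}"
  have "openin (Pow_topology T) U"
    unfolding openin_Pow_topology
  proof (intro conjI ballI)
    show "U \<subseteq> Pow T" by (auto simp: U_def)
    fix S assume "S \<in> U"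
    then obtain F where F: "finite F" "F \<subseteq> T" "{Q \<in> rays T r. \<forall>t\<in>F. t \<in> Q \<longleftrightarrow> t \<in> S} \<subseteq> V"
      by (auto simp: U_def)
    have "S' \<in> U" if "S' \<subseteq> T" "\<forall>t\<in>F. t \<in> S' \<longleftrightarrow> t \<in> S" for S'
      unfolding U_def using F that by (intro CollectI conjI exI[of _ F]) auto
    then show "\<exists>F. finite F \<and> F \<subseteq> T \<and> (\<forall>Q\<subseteq>T. (\<forall>t\<in>F. t \<in> Q \<longleftrightarrow> t \<in> S) \<longrightarrow> Q \<in> U)"
      using F by blast
  qed
  moreover have "V = U \<inter> rays T r"
  proof (intro equalityI subsetI IntI)
    fix R assume R: "R \<in> V"
    then have "R \<in> rays T r" using r by blast
    then show "R \<in> U" unfolding U_def using r R by (auto simp: rays_def)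
    show "R \<in> rays T r" by fact
  next
    fix R assume "R \<in> U \<inter> rays T r"
    then show "R \<in> V" unfolding U_def by blast
  qed
  ultimately show ?l
    by (auto simp: rays_topology_def openin_subtopology)
qed

text \<open>\<open>f\<close> is a homeomorphism onto the space of rays, expressed through neighbourhoods in \<open>X\<close>.\<close>

definition ray_coding :: "'a topology \<Rightarrow> 'b set \<Rightarrow> 'b rel \<Rightarrow> ('a \<Rightarrow> 'b set) \<Rightarrow> bool" where
  "ray_coding X T r f \<longleftrightarrow>
     tree_on T r \<and> bij_betw f (topspace X) (rays T r) \<and>
     (\<forall>W\<subseteq>topspace X. openin X W \<longleftrightarrow>
        (\<forall>x\<in>W. \<exists>F. finite F \<and> F \<subseteq> T \<and> {y \<in> topspace X. \<forall>t\<in>F. t \<in> f y \<longleftrightarrow> t \<in> f x} \<subseteq> W))"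

text \<open>Transfers the topology once and for all: afterwards both directions compare
  \<open>f y\<close> with \<open>f x\<close> on finite sets of nodes and never return to the power
  set.\<close>

lemma ray_space_iff_ray_coding:
  fixes X :: "'a topology"
  shows "ray_space TYPE('b) X \<longleftrightarrow> (\<exists>(T :: 'b set) r f. ray_coding X T r f)"
proof -
  have image: "openin (rays_topology T r) (f ` W) \<longleftrightarrow>
      (\<forall>x\<in>W. \<exists>F. finite F \<and> F \<subseteq> T \<and> {y \<in> topspace X. \<forall>t\<in>F. t \<in> f y \<longleftrightarrow> t \<in> f x} \<subseteq> W)"
    if bij: "bij_betw f (topspace X) (rays T r)" and W: "W \<subseteq> topspace X"
    for f and T :: "'b set" and r W
  proof -
    have "{Q \<in> rays T r. \<forall>t\<in>F. t \<in> Q \<longleftrightarrow> t \<in> f x} =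
        f ` {y \<in> topspace X. \<forall>t\<in>F. t \<in> f y \<longleftrightarrow> t \<in> f x}" for F x
      unfolding bij_betw_imp_surj_on[OF bij, symmetric] by auto
    then have "{Q \<in> rays T r. \<forall>t\<in>F. t \<in> Q \<longleftrightarrow> t \<in> f x} \<subseteq> f ` W \<longleftrightarrow>
        {y \<in> topspace X. \<forall>t\<in>F. t \<in> f y \<longleftrightarrow> t \<in> f x} \<subseteq> W" for F x
      using inj_on_image_subset_iff[OF bij_betw_imp_inj_on[OF bij] _ W] by simp
    moreover have "f ` W \<subseteq> rays T r" using bij W by (auto simp: bij_betw_def)
    ultimately show ?thesis by (simp add: openin_rays_topology)
  qed
  have homeo: "homeomorphic_map X (rays_topology T r) f \<longleftrightarrow>
      bij_betw f (topspace X) (rays T r) \<and> (\<forall>W\<subseteq>topspace X. openin X W \<longleftrightarrow> openin (rays_topology T r) (f ` W))"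
    (is "?l \<longleftrightarrow> ?r") for f and T :: "'b set" and r
  proof
    assume h: ?l
    then show ?r
      using homeomorphic_map_openness[OF h] homeomorphic_imp_surjective_map[OF h]
        homeomorphic_imp_injective_map[OF h]
      by (auto simp: bij_betw_def topspace_rays_topology)
  next
    assume r: ?r
    then have "rays T r = f ` topspace X" by (simp add: bij_betw_def)
    then have "f ` {x \<in> topspace X. f x \<in> U} = U" if "U \<subseteq> rays T r" for U
      using that by auto
    then have "openin X {x \<in> topspace X. f x \<in> U} \<longleftrightarrow> openin (rays_topology T r) U" if "U \<subseteq> rays T r" for U
      using r that by auto
    then show ?l
      using r by (simp add: homeomorphic_map_def quotient_map_def topspace_rays_topology bij_betw_def)
  qed
  have coding: "tree_on T r \<and> homeomorphic_map X (rays_topology T r) f \<longleftrightarrow> ray_coding X T r f"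
    for f and T :: "'b set" and r
    by (cases "bij_betw f (topspace X) (rays T r)") (simp_all add: homeo image ray_coding_def)
  show ?thesis
    unfolding ray_space_def homeomorphic_space coding[symmetric] by simp
qed

section \<open>Runs of the game\<close>

lemma not_less_first_inning: "first_inning \<alpha> \<Longrightarrow> \<not> \<beta> < \<alpha>"
  by (simp add: first_inning_def not_less)

text \<open>The set on which Alice has to move. In inning zero the intersection over the empty
  family is \<open>UNIV\<close>, and the factor \<open>topspace X\<close> corrects it to the whole
  space.\<close>

definition position :: "'a topology \<Rightarrow> ('a inning \<Rightarrow> 'a set) \<Rightarrow> 'a inning \<Rightarrow> 'a set" where
  "position X U \<alpha> = topspace X \<inter> (\<Inter>\<beta>\<in>{..<\<alpha>}. U \<beta>)"

lemma position_cong: "(\<And>\<beta>. \<beta> < \<alpha> \<Longrightarrow> U \<beta> = V \<beta>) \<Longrightarrow> position X U \<alpha> = position X V \<alpha>"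
  by (simp add: position_def)

lemma legal_cong:
  assumes "\<And>\<beta>. \<beta> < \<alpha> \<Longrightarrow> U \<beta> = V \<beta>"
  shows "legal X \<alpha> U m \<longleftrightarrow> legal X \<alpha> V m"
proof -
  have "{U \<beta> - \<Union>\<F> |\<beta> \<F>. \<beta> < \<alpha> \<and> \<F> \<subseteq> P \<and> finite \<F>} = {V \<beta> - \<Union>\<F> |\<beta> \<F>. \<beta> < \<alpha> \<and> \<F> \<subseteq> P \<and> finite \<F>}" for P
    using assms by (metis (no_types, opaque_lifting))
  moreover have "(\<Inter>\<beta>\<in>{..<\<alpha>}. U \<beta>) = (\<Inter>\<beta>\<in>{..<\<alpha>}. V \<beta>)"
    using assms by simp
  moreover have "(\<exists>\<beta>. next_inning \<beta> \<alpha> \<and> open_partition X (U \<beta>) P) \<longleftrightarrow>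
      (\<exists>\<beta>. next_inning \<beta> \<alpha> \<and> open_partition X (V \<beta>) P)" for P
    using assms by (metis next_inning_def)
  ultimately show ?thesis
    by (simp add: legal_def split: move.split)
qed

lemma answers_cong: "(\<And>\<beta>. \<beta> < \<alpha> \<Longrightarrow> U \<beta> = V \<beta>) \<Longrightarrow> answers \<sigma> U \<alpha> = answers \<sigma> V \<alpha>"
  unfolding answers_def by (metis lessThan_iff restrict_ext)

lemma played_mono: "played X \<alpha> A U \<Longrightarrow> \<beta> \<le> \<alpha> \<Longrightarrow> played X \<beta> A U"
  by (auto simp: played_def)

lemma pieces_open: "legal X \<alpha> U m \<Longrightarrow> V \<in> pieces m \<Longrightarrow> openin X V \<and> V \<noteq> {}"
  by (auto simp: legal_def open_partition_def partition_on_def split: move.splits)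

lemma disjoint_pieces:
  "legal X \<alpha> U m \<Longrightarrow> V \<in> pieces m \<Longrightarrow> W \<in> pieces m \<Longrightarrow> x \<in> V \<Longrightarrow> x \<in> W \<Longrightarrow> V = W"
  by (auto simp: legal_def open_partition_def partition_on_def disjoint_def split: move.splits)

lemma played_open:
  assumes "played X \<alpha> A U" "\<beta> < \<alpha>"
  shows "openin X (U \<beta>)" "U \<beta> \<noteq> {}"
  using assms pieces_open[of X \<beta> U "A \<beta>" "U \<beta>"] by (auto simp: played_def)

text \<open>A piece of a limit inning lies in all earlier moves at once; only the successor case
  passes through the predecessor and uses induction.\<close>

lemma played_antimono:
  assumes "played X \<alpha> A U" "\<beta> < \<alpha>" "\<gamma> \<le> \<beta>"
  shows "U \<beta> \<subseteq> U \<gamma>"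
  using assms(2,3)
proof (induction \<beta> rule: less_induct)
  case (less \<beta>)
  show ?case
  proof (cases "\<gamma> = \<beta>")
    case False
    with less have lt: "\<gamma> < \<beta>" by simp
    then have nf: "\<not> first_inning \<beta>" using not_less_first_inning[of \<beta>] by metis
    have m: "legal X \<beta> U (A \<beta>)" "U \<beta> \<in> pieces (A \<beta>)"
      using assms(1) less.prems(1) by (auto simp: played_def)
    show ?thesis
    proof (cases "A \<beta>")
      case (Partition P)
      with m nf obtain \<delta> where d: "next_inning \<delta> \<beta>" "open_partition X (U \<delta>) P"
        by (auto simp: legal_def)
      then have "U \<beta> \<subseteq> U \<delta>"
        using m(2) Partition by (auto simp: open_partition_def partition_on_def)
      moreover have "\<delta> < \<beta>" "\<gamma> \<le> \<delta>"
        using d(1) lt by (auto simp: next_inning_def)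
      ultimately show ?thesis
        using less.IH[of \<delta>] less.prems(1) by (meson order.strict_trans subset_trans)
    next
      case (Limit P x)
      with m have "U \<beta> \<subseteq> (\<Inter>\<beta>\<in>{..<\<beta>}. U \<beta>)" by (auto simp: legal_def)
      then show ?thesis using lt by blast
    qed
  qed simp
qed

lemma position_next:
  assumes "played X \<alpha> A U" "next_inning \<beta> \<alpha>"
  shows "position X U \<alpha> = U \<beta>"
proof -
  have "\<beta> < \<alpha>" "\<And>\<gamma>. \<gamma> < \<alpha> \<Longrightarrow> \<gamma> \<le> \<beta>" using assms(2) by (auto simp: next_inning_def)
  moreover have "U \<beta> \<subseteq> topspace X" using played_open(1)[OF assms(1)] calculation(1) openin_subset by blast
  moreover have "U \<beta> \<subseteq> U \<gamma>" if "\<gamma> < \<alpha>" for \<gamma>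
    using played_antimono[OF assms(1)] calculation that by blast
  ultimately show ?thesis unfolding position_def by blast
qed

lemma position_first: "first_inning \<alpha> \<Longrightarrow> position X U \<alpha> = topspace X"
  using not_less_first_inning[of \<alpha>] by (auto simp: position_def)

lemma position_limit:
  assumes "played X \<alpha> A U" "limit_inning \<alpha>"
  shows "position X U \<alpha> = (\<Inter>\<beta>\<in>{..<\<alpha>}. U \<beta>)"
proof -
  obtain \<beta> where b: "\<beta> < \<alpha>"
    using assms(2) unfolding limit_inning_def first_inning_def by (meson not_le)
  then have "U \<beta> \<subseteq> topspace X" using played_open(1)[OF assms(1)] openin_subset by blast
  then show ?thesis using b unfolding position_def by blast
qed

text \<open>In terms of \<open>position\<close>, inning zero and the successor innings obey one
  rule, so later arguments only distinguish limit innings from the others.\<close>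

lemma legal_Partition:
  assumes "played X \<alpha> A U"
  shows "legal X \<alpha> U (Partition P) \<longleftrightarrow> \<not> limit_inning \<alpha> \<and> open_partition X (position X U \<alpha>) P"
proof -
  consider "first_inning \<alpha>" | "limit_inning \<alpha>" "\<not> first_inning \<alpha>" | \<beta> where "next_inning \<beta> \<alpha>" "\<not> first_inning \<alpha>"
    unfolding limit_inning_def by blast
  then show ?thesis
  proof cases
    case 1
    then have "\<not> next_inning \<beta> \<alpha>" for \<beta> using not_less_first_inning[of \<alpha> \<beta>] by (simp add: next_inning_def)
    with 1 show ?thesis by (auto simp: legal_def limit_inning_def position_first)
  next
    case 2
    then show ?thesis by (auto simp: legal_def limit_inning_def)
  next
    case 3
    have "next_inning \<gamma> \<alpha> \<longleftrightarrow> \<gamma> = \<beta>" for \<gamma>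
      using 3(1) unfolding next_inning_def by (metis order.antisym)
    then have "legal X \<alpha> U (Partition P) \<longleftrightarrow> open_partition X (U \<beta>) P"
      using 3(2) by (simp add: legal_def)
    with 3 show ?thesis
      unfolding limit_inning_def position_next[OF assms 3(1)] by blast
  qed
qed

lemma legal_Limit:
  assumes "played X \<alpha> A U"
  shows "legal X \<alpha> U (Limit P x) \<longleftrightarrow>
    limit_inning \<alpha> \<and> disjoint P \<and> (\<forall>V\<in>P. openin X V \<and> V \<noteq> {}) \<and> x \<in> topspace X \<and>
    position X U \<alpha> = \<Union>P \<union> {x} \<and> x \<notin> \<Union>P \<and>
    local_basis X x {U \<beta> - \<Union>\<F> |\<beta> \<F>. \<beta> < \<alpha> \<and> \<F> \<subseteq> P \<and> finite \<F>}"
  using position_limit[OF assms] by (auto simp: legal_def)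

text \<open>The least inning above \<beta> stays below \<alpha>, since \<alpha> is no successor. In
  both directions this is the source of rays without maximal element.\<close>

lemma limit_inning_between:
  "limit_inning \<alpha> \<Longrightarrow> \<beta> < \<alpha> \<Longrightarrow> \<exists>\<gamma>. next_inning \<beta> \<gamma> \<and> \<gamma> < \<alpha>"
proof -
  assume a: "limit_inning \<alpha>" "\<beta> < \<alpha>"
  then have "\<not> next_inning \<beta> \<alpha>" by (auto simp: limit_inning_def)
  then obtain \<gamma> where g: "\<beta> < \<gamma>" "\<gamma> < \<alpha>"
    using a(2) unfolding next_inning_def by (meson not_le)
  define \<delta> where "\<delta> = (LEAST \<gamma>. \<beta> < \<gamma>)"
  have "\<beta> < \<delta>" "\<delta> \<le> \<gamma>" using g unfolding \<delta>_def by (auto intro: LeastI Least_le)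
  moreover have "\<epsilon> \<le> \<beta>" if "\<epsilon> < \<delta>" for \<epsilon>
    using that not_less_Least[of \<epsilon> "\<lambda>\<gamma>. \<beta> < \<gamma>"] unfolding \<delta>_def by simp
  ultimately have "next_inning \<beta> \<delta>" "\<delta> < \<alpha>"
    using g(2) by (simp_all add: next_inning_def)
  then show ?thesis by blast
qed

lemma limit_inning_nonempty: "limit_inning \<alpha> \<Longrightarrow> \<exists>\<beta>. \<beta> < \<alpha>"
  unfolding limit_inning_def first_inning_def by (meson not_le)

section \<open>From a tree to a winning strategy\<close>

locale ray_coded =
  fixes X :: "'a topology" and T :: "'b set" and r :: "'b rel" and f :: "'a \<Rightarrow> 'b set"
  assumes coding: "ray_coding X T r f" and nonempty: "topspace X \<noteq> {}"
begin

definition node_cone :: "'b \<Rightarrow> 'a set" where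
  "node_cone t = {x \<in> topspace X. t \<in> f x}"

definition common :: "'a set \<Rightarrow> 'b set" where
  "common S = {t \<in> T. \<forall>x\<in>S. t \<in> f x}"

text \<open>Requiring the strict predecessors of \<open>t\<close> to be exactly the common nodes
  makes \<open>t\<close> minimal outside them. A node may lie on no ray; its empty cone is not
  allowed as a piece.\<close>

definition subcones :: "'a set \<Rightarrow> 'a set set" where
  "subcones S = {node_cone t |t. t \<in> T \<and> underS r t = common S \<and> node_cone t \<noteq> {}}"

text \<open>If the position \<open>S\<close> contains a point whose ray consists of the nodes common to all points of
  \<open>S\<close>, the tree branches only above this ray, and Alice waits for the next limit inning.\<close>

definition tree_strategy :: "'a strategy" where
  "tree_strategy \<alpha> U =
     (let S = position X U \<alpha> in
      if limit_inning \<alpha> then Limit (subcones S) (SOME x. x \<in> topspace X \<and> f x = common S)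
      else Partition (if \<exists>x\<in>S. f x = common S then {S} else subcones S))"

lemma answers_tree_strategy: "answers tree_strategy U \<alpha> = tree_strategy \<alpha> U"
proof -
  have "position X (restrict U {..<\<alpha>}) \<alpha> = position X U \<alpha>"
    by (rule position_cong) simp
  then show ?thesis by (simp add: answers_def tree_strategy_def)
qed

section \<open>Cones and the nodes common to a set of points\<close>

lemma tree: "tree_on T r"
  and bij: "bij_betw f (topspace X) (rays T r)"
  using coding by (auto simp: ray_coding_def)

lemma openin_coded:
  "W \<subseteq> topspace X \<Longrightarrow> openin X W \<longleftrightarrow>
     (\<forall>x\<in>W. \<exists>F. finite F \<and> F \<subseteq> T \<and> {y \<in> topspace X. \<forall>t\<in>F. t \<in> f y \<longleftrightarrow> t \<in> f x} \<subseteq> W)"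
  using coding by (auto simp: ray_coding_def)

lemma r_sub: "r \<subseteq> T \<times> T"
  using tree by (simp add: tree_on_def partial_order_on_def preorder_on_def)

lemma r_trans: "(a, b) \<in> r \<Longrightarrow> (b, c) \<in> r \<Longrightarrow> (a, c) \<in> r"
  using tree by (auto simp: tree_on_def partial_order_on_def preorder_on_def dest: transD)

lemma f_ray: "x \<in> topspace X \<Longrightarrow> f x \<in> rays T r"
  using bij by (auto simp: bij_betw_def)

lemma f_down: "x \<in> topspace X \<Longrightarrow> t \<in> f x \<Longrightarrow> (s, t) \<in> r \<Longrightarrow> s \<in> f x"
  using f_ray[of x] r_sub unfolding rays_def by blast

lemma f_subset: "x \<in> topspace X \<Longrightarrow> f x \<subseteq> T"
  using f_ray[of x] unfolding rays_def by blast

lemma f_comparable: "x \<in> topspace X \<Longrightarrow> s \<in> f x \<Longrightarrow> t \<in> f x \<Longrightarrow> (s, t) \<in> r \<or> (t, s) \<in> r"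
  using f_ray[of x] unfolding rays_def Chains_def by blast

lemma open_cone: "t \<in> T \<Longrightarrow> openin X (node_cone t)"
  by (subst openin_coded) (auto simp: node_cone_def intro!: exI[of _ "{t}"])

lemma closed_cone: "t \<in> T \<Longrightarrow> closedin X (node_cone t)"
proof -
  assume "t \<in> T"
  then have "openin X (topspace X - node_cone t)"
    by (subst openin_coded) (auto simp: node_cone_def intro!: exI[of _ "{t}"])
  then show ?thesis by (auto simp: closedin_def node_cone_def)
qed

text \<open>The nodes below \<open>s\<close> are well-ordered, so there is a first one outside
  \<open>D\<close>. It lies on the ray \<open>f x\<close> together with \<open>D\<close>, and since
  \<open>D\<close> is downward closed, comparability puts all of \<open>D\<close> strictly below
  it.\<close>

lemma least_above:
  assumes "x \<in> topspace X" "D \<subseteq> f x" "s \<in> f x" "s \<notin> D"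
    and down: "\<And>a b. a \<in> D \<Longrightarrow> (b, a) \<in> r \<Longrightarrow> b \<in> D"
  obtains s' where "(s', s) \<in> r" "s' \<in> f x" "s' \<notin> D" "underS r s' = D"
proof -
  have sT: "s \<in> T" using f_subset assms by blast
  then have wo: "well_order_on (under r s) (Restr r (under r s))"
    and ref: "(s, s) \<in> r"
    using tree by (auto simp: tree_on_def partial_order_on_def preorder_on_def refl_on_def)
  then have wf: "wf (Restr r (under r s) - Id)" by (simp add: well_order_on_def)
  have "s \<in> under r s - D" using ref assms by (auto simp: under_def)
  from wfE_min[OF wf this] obtain s' where
    s': "s' \<in> under r s - D" "\<And>u. (u, s') \<in> Restr r (under r s) - Id \<Longrightarrow> u \<notin> under r s - D"
    by blast
  have le: "(s', s) \<in> r" and nD: "s' \<notin> D" using s'(1) by (auto simp: under_def)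
  have s'f: "s' \<in> f x" using f_down assms le by blast
  have "underS r s' = D"
  proof (intro equalityI subsetI)
    fix u assume "u \<in> underS r s'"
    then have u: "(u, s') \<in> r" "u \<noteq> s'" by (auto simp: underS_def)
    then have "(u, s) \<in> r" using le r_trans by blast
    then show "u \<in> D" using s'(2)[of u] s'(1) u by (auto simp: under_def)
  next
    fix u assume u: "u \<in> D"
    then have "(s', u) \<notin> r" using down nD by blast
    then have "(u, s') \<in> r" using f_comparable[of x u s'] assms s'f u by blast
    then show "u \<in> underS r s'" using u nD by (auto simp: underS_def)
  qed
  then show ?thesis using that le s'f nD by blast
qed

lemma common_down:
  "S \<subseteq> topspace X \<Longrightarrow> t \<in> common S \<Longrightarrow> (s, t) \<in> r \<Longrightarrow> s \<in> common S"
  using f_down r_sub unfolding common_def by blast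

lemma common_subset: "x \<in> S \<Longrightarrow> common S \<subseteq> f x"
  by (auto simp: common_def)

lemma common_antimono: "S \<subseteq> S' \<Longrightarrow> common S' \<subseteq> common S"
  by (auto simp: common_def)

lemma subcone_above:
  assumes "S \<subseteq> topspace X" "x \<in> topspace X" "common S \<subseteq> f x" "s \<in> f x" "s \<notin> common S"
  obtains s' where "node_cone s' \<in> subcones S" "x \<in> node_cone s'" "(s', s) \<in> r"
proof -
  obtain s' where s': "(s', s) \<in> r" "s' \<in> f x" "s' \<notin> common S" "underS r s' = common S"
    using least_above[OF assms(2,3,4,5)] common_down[OF assms(1)] by blast
  then have "s' \<in> T" "x \<in> node_cone s'" using r_sub assms(2) by (auto simp: node_cone_def)
  then show ?thesis using that s' unfolding subcones_def by blast
qed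

lemma subconesE:
  assumes "V \<in> subcones S"
  obtains s where "V = node_cone s" "s \<in> T" "underS r s = common S" "V \<noteq> {}"
  using assms unfolding subcones_def by blast

text \<open>A common point puts both vertices on one ray, so if they differ, one is a strict
  predecessor of the other. As both have the same strict predecessors, it would strictly precede
  itself.\<close>

lemma disjoint_subcones: "disjoint (subcones S)"
proof (rule disjointI)
  fix V W assume VW: "V \<in> subcones S" "W \<in> subcones S" "V \<noteq> W"
  show "V \<inter> W = {}"
  proof (rule ccontr)
    assume "V \<inter> W \<noteq> {}"
    then obtain y where y: "y \<in> V" "y \<in> W" by blast
    obtain s where s: "V = node_cone s" "underS r s = common S" using VW by (elim subconesE) blast
    obtain t where t: "W = node_cone t" "underS r t = common S" using VW by (elim subconesE) blast
    have "s \<noteq> t" using s t VW by blast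
    moreover have "(s, t) \<in> r \<or> (t, s) \<in> r"
      using f_comparable[of y s t] y s t by (auto simp: node_cone_def)
    ultimately have "s \<in> underS r t \<or> t \<in> underS r s" by (auto simp: underS_def)
    then have "s \<in> underS r s \<or> t \<in> underS r t" using s t by simp
    then show False by (auto simp: underS_def)
  qed
qed

lemma subcones_open: "V \<in> subcones S \<Longrightarrow> openin X V \<and> closedin X V \<and> V \<noteq> {}"
  by (elim subconesE) (auto simp: open_cone closed_cone)

text \<open>Ensures that the discarded point, whose ray is just \<open>common S\<close>, lies in
  none of the pieces.\<close>

lemma subcone_common: "V \<in> subcones S \<Longrightarrow> y \<in> V \<Longrightarrow> y \<in> topspace X \<and> common S \<subseteq> f y \<and> f y \<noteq> common S"
proof (elim subconesE)
  fix s assume a: "y \<in> V" "V = node_cone s" "s \<in> T" "underS r s = common S"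
  then have y: "y \<in> topspace X" "s \<in> f y" by (auto simp: node_cone_def)
  have "common S \<subseteq> f y"
    using f_down[OF y] a(4) by (auto simp: underS_def)
  moreover have "s \<notin> common S" using a(4) by (auto simp: underS_def)
  ultimately show "y \<in> topspace X \<and> common S \<subseteq> f y \<and> f y \<noteq> common S" using y by blast
qed

lemma open_partition_cone:
  assumes "t \<in> T" "node_cone t \<noteq> {}"
  shows "open_partition X (node_cone t) (if \<exists>x\<in>node_cone t. f x = common (node_cone t) then {node_cone t} else subcones (node_cone t))"
proof (cases "\<exists>x\<in>node_cone t. f x = common (node_cone t)")
  case True
  then show ?thesis using assms open_cone by (simp add: open_partition_def partition_on_def)
next
  case False
  have sub: "node_cone t \<subseteq> topspace X" by (auto simp: node_cone_def)
  \<comment> \<open>A ray through all common nodes passes through \<open>t\<close> in particular, so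
    the subcones stay inside the cone. For this it matters that the position is a cone.\<close>
  have tc: "t \<in> common (node_cone t)" using assms by (auto simp: common_def node_cone_def)
  have "\<Union>(subcones (node_cone t)) = node_cone t"
  proof (intro equalityI subsetI)
    fix y assume "y \<in> \<Union>(subcones (node_cone t))"
    then have "y \<in> topspace X" "common (node_cone t) \<subseteq> f y" using subcone_common by blast+
    then show "y \<in> node_cone t" using tc by (auto simp: node_cone_def)
  next
    fix y assume y: "y \<in> node_cone t"
    then have "common (node_cone t) \<subseteq> f y" "f y \<noteq> common (node_cone t)" "y \<in> topspace X"
      using False common_subset sub by blast+
    then obtain s where "s \<in> f y" "s \<notin> common (node_cone t)" by blast
    then show "y \<in> \<Union>(subcones (node_cone t))"
      using subcone_above[OF sub \<open>y \<in> topspace X\<close> \<open>common (node_cone t) \<subseteq> f y\<close>] by blast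
  qed
  then have "open_partition X (node_cone t) (subcones (node_cone t))"
    using disjoint_subcones[of "node_cone t"] subcones_open[of _ "node_cone t"]
    unfolding open_partition_def partition_on_def by blast
  with False show ?thesis by simp
qed

section \<open>The tree strategy always has a legal move\<close>

lemma cone_root: "\<exists>t\<in>T. node_cone t = topspace X"
proof -
  obtain t where t: "t \<in> T" "\<forall>s\<in>T. (t, s) \<in> r" using tree by (auto simp: tree_on_def)
  have "t \<in> f x" if x: "x \<in> topspace X" for x
  proof -
    obtain s where "s \<in> f x" "s \<in> T" using f_ray[OF x] by (auto simp: rays_def)
    then show ?thesis using f_down[OF x, of s t] t by blast
  qed
  then show ?thesis using t(1) by (auto simp: node_cone_def)
qed

text \<open>The invariant of the strategy. Alice offers cones or, outside limit innings, the
  position itself, which is the previous move or the whole space, the cone of the root.\<close>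

lemma played_cone:
  assumes "played X \<alpha> (answers tree_strategy U) U" "\<beta> < \<alpha>"
  shows "\<exists>t\<in>T. U \<beta> = node_cone t"
  using assms(2)
proof (induction \<beta> rule: less_induct)
  case (less \<beta>)
  have U: "U \<beta> \<in> pieces (tree_strategy \<beta> U)"
    using assms(1) less.prems unfolding played_def answers_tree_strategy by blast
  have pl: "played X \<beta> (answers tree_strategy U) U"
    using played_mono[OF assms(1)] less.prems by (meson less_imp_le)
  show ?case
  proof (cases "U \<beta> \<in> subcones (position X U \<beta>)")
    case True
    then show ?thesis by (elim subconesE) blast
  next
    case False
    then have eq: "U \<beta> = position X U \<beta>" and nl: "\<not> limit_inning \<beta>"
      using U by (auto simp: tree_strategy_def Let_def split: if_splits)
    from nl consider "first_inning \<beta>" | \<gamma> where "next_inning \<gamma> \<beta>" unfolding limit_inning_def by blast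
    then show ?thesis
    proof cases
      case 1
      then show ?thesis using cone_root eq position_first by metis
    next
      case 2
      then have "\<gamma> < \<beta>" by (simp add: next_inning_def)
      then have "\<exists>t\<in>T. U \<gamma> = node_cone t" using less by (meson order.strict_trans)
      then show ?thesis using eq position_next[OF pl 2] by simp
    qed
  qed
qed

lemma legal_tree_strategy_nonlimit:
  assumes pl: "played X \<alpha> (answers tree_strategy U) U" and nl: "\<not> limit_inning \<alpha>"
  shows "legal X \<alpha> U (tree_strategy \<alpha> U)"
proof -
  have "\<exists>t. t \<in> T \<and> position X U \<alpha> = node_cone t \<and> node_cone t \<noteq> {}"
  proof -
    from nl consider "first_inning \<alpha>" | \<gamma> where "next_inning \<gamma> \<alpha>" unfolding limit_inning_def by blast
    then show ?thesis
    proof cases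
      case 1
      then show ?thesis using cone_root position_first nonempty by metis
    next
      case 2
      then have "\<gamma> < \<alpha>" by (simp add: next_inning_def)
      then show ?thesis
        using played_cone[OF pl] played_open(2)[OF pl] position_next[OF pl 2] by metis
    qed
  qed
  then obtain t where "t \<in> T" "position X U \<alpha> = node_cone t" "node_cone t \<noteq> {}" by blast
  then show ?thesis
    using open_partition_cone[of t] nl
    by (simp add: tree_strategy_def Let_def legal_Partition[OF pl] del: if_split)
qed

text \<open>The common nodes grow as the moves shrink. Their union is a ray, and surjectivity of
  \<open>f\<close> turns it into the point that Alice can discard.\<close>

lemma limit_ray:
  assumes pl: "played X \<alpha> (answers tree_strategy U) U" and lim: "limit_inning \<alpha>"
  obtains x where "x \<in> topspace X" "f x = (\<Union>\<beta>\<in>{..<\<alpha>}. common (U \<beta>))"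
proof -
  let ?D = "\<Union>\<beta>\<in>{..<\<alpha>}. common (U \<beta>)"
  have U: "U \<beta> \<subseteq> topspace X" "U \<beta> \<noteq> {}" if "\<beta> < \<alpha>" for \<beta>
    using played_open[OF pl that] openin_subset by blast+
  have mono: "common (U \<gamma>) \<subseteq> common (U \<beta>)" if "\<gamma> \<le> \<beta>" "\<beta> < \<alpha>" for \<beta> \<gamma>
    using played_antimono[OF pl that(2,1)] by (rule common_antimono)
  have "?D \<in> rays T r"
    unfolding rays_def
  proof (intro CollectI conjI ballI impI)
    obtain \<beta> where b: "\<beta> < \<alpha>" using limit_inning_nonempty[OF lim] by blast
    obtain t where "t \<in> T" "U \<beta> = node_cone t" using played_cone[OF pl b] by blast
    then have "t \<in> common (U \<beta>)" by (auto simp: common_def node_cone_def)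
    then show "?D \<noteq> {}" using b by blast
    show "?D \<subseteq> T" by (auto simp: common_def)
    show "?D \<in> Chains r"
      unfolding Chains_def
    proof (intro CollectI ballI)
      fix a b assume "a \<in> ?D" "b \<in> ?D"
      then obtain \<beta> \<gamma> where bg: "\<beta> < \<alpha>" "a \<in> common (U \<beta>)" "\<gamma> < \<alpha>" "b \<in> common (U \<gamma>)" by blast
      define \<delta> where "\<delta> = max \<beta> \<gamma>"
      have d: "\<delta> < \<alpha>" "\<beta> \<le> \<delta>" "\<gamma> \<le> \<delta>" using bg by (simp_all add: \<delta>_def)
      then have "a \<in> common (U \<delta>)" "b \<in> common (U \<delta>)" using mono bg by blast+
      moreover obtain x where "x \<in> U \<delta>" "x \<in> topspace X" using U[OF d(1)] by blast
      ultimately show "(a, b) \<in> r \<or> (b, a) \<in> r" using f_comparable common_subset by blast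
    qed
    show "s \<in> ?D" if "t \<in> ?D" "(s, t) \<in> r" for s t
      using that common_down U by blast
    show "\<not> (\<exists>m\<in>?D. \<forall>t\<in>?D. (m, t) \<in> r \<longrightarrow> t = m)"
    proof
      assume "\<exists>m\<in>?D. \<forall>t\<in>?D. (m, t) \<in> r \<longrightarrow> t = m"
      then obtain m \<beta> where m: "\<forall>t\<in>?D. (m, t) \<in> r \<longrightarrow> t = m" "\<beta> < \<alpha>" "m \<in> common (U \<beta>)" by blast
      obtain \<gamma> where g: "next_inning \<beta> \<gamma>" "\<gamma> < \<alpha>" using limit_inning_between[OF lim m(2)] by blast
      have pos: "position X U \<gamma> = U \<beta>"
        using position_next[OF played_mono[OF pl] g(1)] g(2) by (meson less_imp_le)
      have "\<not> limit_inning \<gamma>" using g(1) by (auto simp: limit_inning_def)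
      moreover have "U \<gamma> \<in> pieces (tree_strategy \<gamma> U)"
        using pl g(2) unfolding played_def answers_tree_strategy by blast
      \<comment> \<open>Alice's move on \<open>U \<beta>\<close> comes in inning \<gamma>. If she
        waited, \<open>common (U \<beta>)\<close> is itself a ray and has no maximal node; otherwise
        Bob chose the cone of a node strictly above all of
        \<open>common (U \<beta>)\<close>.\<close>
      ultimately consider x where "x \<in> U \<beta>" "f x = common (U \<beta>)" | "U \<gamma> \<in> subcones (U \<beta>)"
        unfolding tree_strategy_def Let_def pos by (auto split: if_splits)
      then show False
      proof cases
        case 1
        then have "f x \<in> rays T r" using f_ray U m(2) by blast
        then obtain t where "t \<in> f x" "(m, t) \<in> r" "t \<noteq> m"
          using m(3) 1 unfolding rays_def by blast
        then show False using m(1,2) 1 by blast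
      next
        case 2
        then obtain s where s: "U \<gamma> = node_cone s" "s \<in> T" "underS r s = common (U \<beta>)" by (elim subconesE)
        then have "s \<in> common (U \<gamma>)" by (auto simp: common_def node_cone_def)
        moreover have "(m, s) \<in> r" "s \<noteq> m" using s(3) m(3) by (auto simp: underS_def)
        ultimately show False using m(1) g(2) by blast
      qed
    qed
  qed
  then have "?D \<in> f ` topspace X" using bij by (simp add: bij_betw_def)
  then show ?thesis using that by blast
qed

lemma legal_tree_strategy_limit:
  assumes pl: "played X \<alpha> (answers tree_strategy U) U" and lim: "limit_inning \<alpha>"
  shows "legal X \<alpha> U (tree_strategy \<alpha> U)"
proof -
  define D where "D = (\<Union>\<beta>\<in>{..<\<alpha>}. common (U \<beta>))"
  define S where "S = position X U \<alpha>"
  have U: "U \<beta> \<subseteq> topspace X" "U \<beta> \<noteq> {}" "openin X (U \<beta>)" if "\<beta> < \<alpha>" for \<beta>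
    using played_open[OF pl that] openin_subset by blast+
  obtain x where x: "x \<in> topspace X" "f x = D"
    using limit_ray[OF pl lim] unfolding D_def by blast
  obtain \<beta>\<^sub>0 where b0: "\<beta>\<^sub>0 < \<alpha>" using limit_inning_nonempty[OF lim] by blast
  \<comment> \<open>Each move is the cone of a node that belongs to \<open>D\<close>, so a ray
    containing \<open>D\<close> has its point in every move.\<close>
  have S: "S = {y \<in> topspace X. D \<subseteq> f y}"
  proof (intro equalityI subsetI)
    fix y assume y: "y \<in> S"
    then have "y \<in> U \<beta>" if "\<beta> < \<alpha>" for \<beta> using that by (auto simp: S_def position_def)
    then have "D \<subseteq> f y" unfolding D_def using common_subset by blast
    then show "y \<in> {y \<in> topspace X. D \<subseteq> f y}" using y by (auto simp: S_def position_def)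
  next
    fix y assume y: "y \<in> {y \<in> topspace X. D \<subseteq> f y}"
    have "y \<in> U \<beta>" if b: "\<beta> < \<alpha>" for \<beta>
    proof -
      obtain t where t: "t \<in> T" "U \<beta> = node_cone t" using played_cone[OF pl b] by blast
      then have "t \<in> common (U \<beta>)" by (auto simp: common_def node_cone_def)
      then have "t \<in> D" using b by (auto simp: D_def)
      then show ?thesis using t y by (auto simp: node_cone_def)
    qed
    then show "y \<in> S" using y by (auto simp: S_def position_def)
  qed
  have subS: "S \<subseteq> topspace X" and xS: "x \<in> S" using S x by auto
  have DT: "D \<subseteq> T" by (auto simp: D_def common_def)
  \<comment> \<open>No further node becomes common at the limit, because \<open>x\<close> belongs to
    \<open>S\<close> and its ray is exactly \<open>D\<close>.\<close>
  have D: "common S = D"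
    using S DT common_subset[OF xS] x(2) by (auto simp: common_def)
  \<comment> \<open>Injectivity of \<open>f\<close> leaves only one candidate for the choice in
    \<open>tree_strategy\<close>.\<close>
  have "(SOME x. x \<in> topspace X \<and> f x = common S) = x"
    using bij x D by (intro some_equality) (auto simp: bij_betw_def inj_on_def)
  then have strat: "tree_strategy \<alpha> U = Limit (subcones S) x"
    using lim by (simp add: tree_strategy_def Let_def S_def)
  have xn: "x \<notin> \<Union>(subcones S)" using subcone_common[of _ S x] x D by blast
  have cover: "S = \<Union>(subcones S) \<union> {x}"
  proof (intro equalityI subsetI)
    fix y assume y: "y \<in> S"
    show "y \<in> \<Union>(subcones S) \<union> {x}"
    proof (cases "f y = D")
      case True
      then show ?thesis using bij x y subS by (auto simp: bij_betw_def inj_on_def)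
    next
      case False
      then obtain s where "s \<in> f y" "s \<notin> common S" using y S D by blast
      moreover have "y \<in> topspace X" "common S \<subseteq> f y" using y S D by auto
      ultimately obtain s' where "node_cone s' \<in> subcones S" "y \<in> node_cone s'"
        using subcone_above[OF subS] by blast
      then show ?thesis by blast
    qed
  next
    fix y assume "y \<in> \<Union>(subcones S) \<union> {x}"
    then show "y \<in> S" using subcone_common[of _ S y] xS S D by blast
  qed
  \<comment> \<open>The core of the local basis: agreement with \<open>x\<close> at a single node
    \<open>t\<close>. Finitely many nodes are then handled by the latest of the innings and the
    union of the removed families.\<close>
  have agree1: "\<exists>\<beta> \<F>. \<beta> < \<alpha> \<and> \<F> \<subseteq> subcones S \<and> finite \<F> \<and> (\<forall>y\<in>U \<beta> - \<Union>\<F>. t \<in> f y \<longleftrightarrow> t \<in> f x)"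
    if t: "t \<in> T" for t
  proof (cases "t \<in> D")
    case True
    then obtain \<beta> where "\<beta> < \<alpha>" "t \<in> common (U \<beta>)" by (auto simp: D_def)
    then have "\<forall>y\<in>U \<beta> - \<Union>{}. t \<in> f y \<longleftrightarrow> t \<in> f x" using True x by (auto simp: common_def)
    then show ?thesis using \<open>\<beta> < \<alpha>\<close> by blast
  next
    case False
    show ?thesis
    proof (cases "\<exists>y\<in>S. t \<in> f y")
      case True
      then obtain y where y: "y \<in> topspace X" "D \<subseteq> f y" "t \<in> f y" using S by blast
      then obtain s' where s': "node_cone s' \<in> subcones S" "(s', t) \<in> r"
        using subcone_above[OF subS, of y t] D False by blast
      \<comment> \<open>Removing one piece suffices: every ray through \<open>t\<close> also passes
        the node \<open>s'\<close> below it. Any earlier move can serve as the surrounding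
        set.\<close>
      have "t \<notin> f z" if z: "z \<in> U \<beta>\<^sub>0 - \<Union>{node_cone s'}" for z
      proof
        assume "t \<in> f z"
        moreover have "z \<in> topspace X" using z U(1)[OF b0] by blast
        ultimately have "z \<in> node_cone s'" using f_down s'(2) by (auto simp: node_cone_def)
        then show False using z by blast
      qed
      then have "\<forall>y\<in>U \<beta>\<^sub>0 - \<Union>{node_cone s'}. t \<in> f y \<longleftrightarrow> t \<in> f x" using False x by blast
      then show ?thesis using b0 s'(1)
        by (intro exI[of _ \<beta>\<^sub>0] exI[of _ "{node_cone s'}"]) auto
    next
      case no: False
      \<comment> \<open>If every move had a ray through \<open>t\<close>, comparing \<open>t\<close>
        with the nodes of \<open>D\<close> along these rays would put all of \<open>D\<close> below
        \<open>t\<close>. Then any such ray contains \<open>D\<close>, its point lies in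
        \<open>S\<close>, and \<open>no\<close> is violated.\<close>
      have "\<exists>\<beta><\<alpha>. \<forall>y\<in>U \<beta>. t \<notin> f y"
      proof (rule ccontr)
        assume "\<not> ?thesis"
        then have ex: "\<exists>y\<in>U \<beta>. t \<in> f y" if "\<beta> < \<alpha>" for \<beta> using that by blast
        have below: "(d, t) \<in> r" if "d \<in> D" for d
        proof -
          obtain \<beta> where b: "\<beta> < \<alpha>" "d \<in> common (U \<beta>)" using \<open>d \<in> D\<close> by (auto simp: D_def)
          obtain y where y: "y \<in> U \<beta>" "t \<in> f y" using ex[OF b(1)] by blast
          have "t \<notin> common (U \<beta>)" using False b(1) by (auto simp: D_def)
          then have "(t, d) \<notin> r" using common_down[OF U(1)[OF b(1)] b(2)] by blast
          moreover have "y \<in> topspace X" "d \<in> f y" using y(1) b U by (auto simp: common_def)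
          ultimately show ?thesis using f_comparable y(2) by blast
        qed
        obtain y where y: "y \<in> U \<beta>\<^sub>0" "t \<in> f y" using ex[OF b0] by blast
        then have "y \<in> topspace X" using U(1)[OF b0] by blast
        then have "y \<in> S" using S below f_down y(2) by blast
        then show False using no y(2) by blast
      qed
      then obtain \<beta> where "\<beta> < \<alpha>" "\<forall>y\<in>U \<beta> - \<Union>{}. t \<in> f y \<longleftrightarrow> t \<in> f x" using False x by auto
      then show ?thesis by blast
    qed
  qed
  have agree: "\<exists>\<beta> \<F>. \<beta> < \<alpha> \<and> \<F> \<subseteq> subcones S \<and> finite \<F> \<and> (\<forall>y\<in>U \<beta> - \<Union>\<F>. \<forall>t\<in>F. t \<in> f y \<longleftrightarrow> t \<in> f x)"
    if "finite F" "F \<subseteq> T" for F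
    using that
  proof (induction F)
    case empty
    then show ?case using b0 by blast
  next
    case (insert t F)
    then obtain \<beta> \<F> where 1: "\<beta> < \<alpha>" "\<F> \<subseteq> subcones S" "finite \<F>"
      "\<forall>y\<in>U \<beta> - \<Union>\<F>. \<forall>t\<in>F. t \<in> f y \<longleftrightarrow> t \<in> f x" by blast
    obtain \<gamma> \<G> where 2: "\<gamma> < \<alpha>" "\<G> \<subseteq> subcones S" "finite \<G>"
      "\<forall>y\<in>U \<gamma> - \<Union>\<G>. t \<in> f y \<longleftrightarrow> t \<in> f x" using agree1[of t] insert.prems by blast
    define \<delta> where "\<delta> = max \<beta> \<gamma>"
    have d: "\<delta> < \<alpha>" "\<beta> \<le> \<delta>" "\<gamma> \<le> \<delta>" using 1(1) 2(1) by (simp_all add: \<delta>_def)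
    then have "U \<delta> \<subseteq> U \<beta>" "U \<delta> \<subseteq> U \<gamma>" using played_antimono[OF pl] by blast+
    then have "\<forall>y\<in>U \<delta> - \<Union>(\<F> \<union> \<G>). \<forall>t\<in>insert t F. t \<in> f y \<longleftrightarrow> t \<in> f x"
      using 1(4) 2(4) by blast
    moreover have "\<F> \<union> \<G> \<subseteq> subcones S" "finite (\<F> \<union> \<G>)" using 1 2 by auto
    ultimately show ?case using d(1) by blast
  qed
  have "local_basis X x {U \<beta> - \<Union>\<F> |\<beta> \<F>. \<beta> < \<alpha> \<and> \<F> \<subseteq> subcones S \<and> finite \<F>}"
    unfolding local_basis_def
  proof (intro conjI ballI allI impI)
    fix B assume "B \<in> {U \<beta> - \<Union>\<F> |\<beta> \<F>. \<beta> < \<alpha> \<and> \<F> \<subseteq> subcones S \<and> finite \<F>}"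
    then obtain \<beta> \<F> where B: "B = U \<beta> - \<Union>\<F>" "\<beta> < \<alpha>" "\<F> \<subseteq> subcones S" "finite \<F>" by blast
    have "closedin X (\<Union>\<F>)"
      using B(3,4) subcones_open by (intro closedin_Union) blast+
    then show "openin X B" using U(3)[OF B(2)] B(1) by (simp add: openin_diff)
    have "x \<in> U \<beta>" using xS B(2) by (auto simp: S_def position_def)
    then show "x \<in> B" using xn B by blast
  next
    fix W assume W: "openin X W \<and> x \<in> W"
    then obtain F where F: "finite F" "F \<subseteq> T" "{y \<in> topspace X. \<forall>t\<in>F. t \<in> f y \<longleftrightarrow> t \<in> f x} \<subseteq> W"
      using openin_coded[OF openin_subset, of W] by blast
    obtain \<beta> \<F> where B: "\<beta> < \<alpha>" "\<F> \<subseteq> subcones S" "finite \<F>"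
      "\<forall>y\<in>U \<beta> - \<Union>\<F>. \<forall>t\<in>F. t \<in> f y \<longleftrightarrow> t \<in> f x" using agree[OF F(1,2)] by blast
    then have "U \<beta> - \<Union>\<F> \<subseteq> W" using F(3) U(1)[OF B(1)] by blast
    then show "\<exists>B\<in>{U \<beta> - \<Union>\<F> |\<beta> \<F>. \<beta> < \<alpha> \<and> \<F> \<subseteq> subcones S \<and> finite \<F>}. B \<subseteq> W"
      using B by blast
  qed
  then show ?thesis
    unfolding strat legal_Limit[OF pl]
    using lim disjoint_subcones subcones_open x(1) cover xn S_def by auto
qed

text \<open>Bob wins a run only by the absence of a legal move, so a strategy that always produces
  one is winning.\<close>

lemma winning_tree_strategy: "Alice_winning_strategy X tree_strategy"
proof -
  have "legal X \<alpha> U (answers tree_strategy U \<alpha>)" if "played X \<alpha> (answers tree_strategy U) U" for \<alpha> U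
    using legal_tree_strategy_limit[OF that] legal_tree_strategy_nonlimit[OF that]
    unfolding answers_tree_strategy by blast
  then show ?thesis
    unfolding Alice_winning_strategy_def Alice_strategy_def finished_run_def won_by_Bob_def by blast
qed

end

section \<open>From a winning strategy to a tree\<close>

locale winning =
  fixes X :: "'a topology" and \<sigma> :: "'a strategy"
  assumes win: "Alice_winning_strategy X \<sigma>" and nonempty: "topspace X \<noteq> {}"
begin

text \<open>Bob's moves in the run that follows \<open>x\<close>, by recursion on innings. Once no
  piece contains \<open>x\<close> the description \<open>THE\<close> is unspecified, so only the
  values before \<open>depth x\<close> carry meaning.\<close>

definition branch :: "'a \<Rightarrow> 'a inning \<Rightarrow> 'a set" where
  "branch x = wfrec {(\<alpha>, \<beta>). \<alpha> < \<beta>}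
     (\<lambda>W \<beta>. THE V. V \<in> pieces (\<sigma> \<beta> (restrict W {..<\<beta>})) \<and> x \<in> V)"

abbreviation reply :: "'a \<Rightarrow> 'a inning \<Rightarrow> 'a move" where
  "reply x \<equiv> answers \<sigma> (branch x)"

definition depth :: "'a \<Rightarrow> 'a inning" where
  "depth x = (LEAST \<beta>. x \<notin> \<Union>(pieces (reply x \<beta>)))"

lemma branch_eq: "branch x \<beta> = (THE V. V \<in> pieces (reply x \<beta>) \<and> x \<in> V)"
proof -
  have cut: "restrict (cut W {(\<alpha>, \<beta>). \<alpha> < \<beta>} \<beta>) {..<\<beta>} = restrict W {..<\<beta>}" for W :: "'a inning \<Rightarrow> 'a set"
    by (rule restrict_ext) (simp add: cut_apply)
  show ?thesis
    unfolding branch_def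
    by (subst wfrec[OF wf]) (simp add: cut answers_def)
qed

lemma branch_eqI:
  assumes "legal X \<beta> U (reply x \<beta>)" "V \<in> pieces (reply x \<beta>)" "x \<in> V"
  shows "branch x \<beta> = V"
proof (subst branch_eq, rule the_equality)
  show "V \<in> pieces (reply x \<beta>) \<and> x \<in> V" using assms by blast
  show "W = V" if "W \<in> pieces (reply x \<beta>) \<and> x \<in> W" for W
    using disjoint_pieces[OF assms(1) _ assms(2) _ assms(3)] that by blast
qed

text \<open>In a limit inning without a legal move the run would be finished and won by Bob. In any
  other inning the trivial partition is available, the position being open and non-empty.\<close>

lemma answer_legal:
  assumes "played X \<alpha> (answers \<sigma> U) U"
  shows "legal X \<alpha> U (answers \<sigma> U \<alpha>)"
proof -
  have "\<exists>m. legal X \<alpha> U m"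
  proof (cases "limit_inning \<alpha>")
    case True
    show ?thesis
    proof (rule ccontr)
      assume no: "\<not> ?thesis"
      then have "finished_run X \<alpha> (answers \<sigma> U) U"
        using assms True by (simp add: finished_run_def won_by_Bob_def)
      then have "won_by_Alice X \<alpha> (answers \<sigma> U) U"
        using win by (simp add: Alice_winning_strategy_def)
      then show False using no by (auto simp: won_by_Alice_def)
    qed
  next
    case False
    have "openin X (position X U \<alpha>) \<and> position X U \<alpha> \<noteq> {}"
    proof -
      from False consider "first_inning \<alpha>" | \<gamma> where "next_inning \<gamma> \<alpha>" unfolding limit_inning_def by blast
      then show ?thesis
      proof cases
        case 1
        then show ?thesis using nonempty by (simp add: position_first)
      next
        case 2
        then have "\<gamma> < \<alpha>" by (simp add: next_inning_def)
        then show ?thesis using played_open[OF assms] position_next[OF assms 2] by simp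
      qed
    qed
    then have "open_partition X (position X U \<alpha>) {position X U \<alpha>}"
      by (auto simp: open_partition_def partition_on_def)
    then show ?thesis using False legal_Partition[OF assms] by blast
  qed
  then show ?thesis
    using win assms by (simp add: Alice_winning_strategy_def Alice_strategy_def)
qed

section \<open>The run that follows a point\<close>

lemma played_branch_if:
  assumes "\<And>\<gamma>. \<gamma> < \<beta> \<Longrightarrow> x \<in> \<Union>(pieces (reply x \<gamma>))"
  shows "played X \<beta> (reply x) (branch x) \<and> (\<forall>\<gamma><\<beta>. x \<in> branch x \<gamma>)"
proof -
  have "legal X \<gamma> (branch x) (reply x \<gamma>) \<and> branch x \<gamma> \<in> pieces (reply x \<gamma>) \<and> x \<in> branch x \<gamma>"
    if "\<gamma> < \<beta>" for \<gamma>
    using that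
  proof (induction \<gamma> rule: less_induct)
    case (less \<gamma>)
    have "\<delta> < \<beta>" if "\<delta> < \<gamma>" for \<delta> using that less.prems by (rule order.strict_trans)
    then have "played X \<gamma> (reply x) (branch x)"
      using less.IH unfolding played_def by blast
    then have l: "legal X \<gamma> (branch x) (reply x \<gamma>)" by (rule answer_legal)
    obtain V where V: "V \<in> pieces (reply x \<gamma>)" "x \<in> V" using assms[OF less.prems] by blast
    have "branch x \<gamma> = V" using branch_eqI[OF l V] .
    then show ?case using l V by simp
  qed
  then show ?thesis by (auto simp: played_def)
qed

text \<open>A point that is never discarded would produce a run through all innings, against
  \<open>every_run_ends\<close>; hence the minimum in \<open>depth\<close> is attained.\<close>

lemma depth_not: "x \<notin> \<Union>(pieces (reply x (depth x)))"
proof -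
  have "\<exists>\<beta>. x \<notin> \<Union>(pieces (reply x \<beta>))"
  proof (rule ccontr)
    assume "\<not> ?thesis"
    then have "x \<in> \<Union>(pieces (reply x \<beta>))" for \<beta> by simp
    then have "played X \<beta> (reply x) (branch x)" for \<beta>
      by (rule conjunct1[OF played_branch_if])
    then show False using every_run_ends by blast
  qed
  then show ?thesis unfolding depth_def by (rule LeastI_ex)
qed

lemma depth_le: "x \<notin> \<Union>(pieces (reply x \<beta>)) \<Longrightarrow> depth x \<le> \<beta>"
  unfolding depth_def by (rule Least_le)

lemma
  shows played_branch: "played X (depth x) (reply x) (branch x)"
    and mem_branch: "\<beta> < depth x \<Longrightarrow> x \<in> branch x \<beta>"
proof -
  have "x \<in> \<Union>(pieces (reply x \<gamma>))" if "\<gamma> < depth x" for \<gamma>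
    using that depth_le[of x \<gamma>] by (meson not_le)
  note * = played_branch_if[OF this]
  show "played X (depth x) (reply x) (branch x)" using * by (rule conjunct1)
  show "\<beta> < depth x \<Longrightarrow> x \<in> branch x \<beta>" using * by simp
qed

text \<open>Equal past moves give equal answers, and among disjoint pieces only one contains
  \<open>z\<close>. So every run against \<sigma> whose moves all contain \<open>z\<close> is an
  initial part of the run of \<open>z\<close>.\<close>

lemma branch_unique:
  assumes pl: "played X \<alpha> (answers \<sigma> U) U" and z: "\<And>\<beta>. \<beta> < \<alpha> \<Longrightarrow> z \<in> U \<beta>"
  shows "\<alpha> \<le> depth z" "\<And>\<beta>. \<beta> < \<alpha> \<Longrightarrow> branch z \<beta> = U \<beta>" "reply z \<alpha> = answers \<sigma> U \<alpha>"
proof -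
  have step: "reply z \<beta> = answers \<sigma> U \<beta> \<and> branch z \<beta> = U \<beta>" if "\<beta> < \<alpha>" for \<beta>
    using that
  proof (induction \<beta> rule: less_induct)
    case (less \<beta>)
    have "\<delta> < \<alpha>" if "\<delta> < \<beta>" for \<delta> using that less.prems by (rule order.strict_trans)
    then have eq: "reply z \<beta> = answers \<sigma> U \<beta>"
      using less.IH by (intro answers_cong) blast
    have m: "legal X \<beta> U (answers \<sigma> U \<beta>)" "U \<beta> \<in> pieces (answers \<sigma> U \<beta>)"
      using pl less.prems by (auto simp: played_def)
    have "branch z \<beta> = U \<beta>"
      using m z[OF less.prems] by (intro branch_eqI[of \<beta> U]) (simp_all add: eq)
    then show ?case using eq by simp
  qed
  then show "\<And>\<beta>. \<beta> < \<alpha> \<Longrightarrow> branch z \<beta> = U \<beta>" by blast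
  then show "reply z \<alpha> = answers \<sigma> U \<alpha>" by (rule answers_cong)
  show "\<alpha> \<le> depth z"
  proof (rule ccontr)
    assume "\<not> \<alpha> \<le> depth z"
    then have d: "depth z < \<alpha>" by simp
    then have "U (depth z) \<in> pieces (reply z (depth z))"
      using pl step[OF d] by (auto simp: played_def)
    then show False using depth_not z[OF d] by blast
  qed
qed

text \<open>The point \<open>x\<close> is in the position but in no piece. A partition would cover
  it, so the answer is a limit move, and there the only uncovered point of the position is the
  discarded one.\<close>

lemma depth_reply:
  assumes x: "x \<in> topspace X"
  shows "limit_inning (depth x) \<and> (\<exists>P. reply x (depth x) = Limit P x)"
proof -
  have l: "legal X (depth x) (branch x) (reply x (depth x))"
    by (rule answer_legal[OF played_branch])
  have pos: "x \<in> position X (branch x) (depth x)"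
    using x mem_branch by (auto simp: position_def)
  show ?thesis
  proof (cases "reply x (depth x)")
    case (Partition P)
    then have "\<Union>P = position X (branch x) (depth x)"
      using l legal_Partition[OF played_branch] by (simp add: open_partition_def partition_on_def)
    then show ?thesis using depth_not[of x] pos Partition by simp
  next
    case (Limit P y)
    then have "limit_inning (depth x)" "position X (branch x) (depth x) = \<Union>P \<union> {y}"
      using l legal_Limit[OF played_branch] by simp_all
    then show ?thesis using depth_not[of x] pos Limit by auto
  qed
qed

lemma depth_limit: "x \<in> topspace X \<Longrightarrow> limit_inning (depth x)"
  using depth_reply by blast

lemma branch_antimono: "\<beta> < depth x \<Longrightarrow> \<gamma> \<le> \<beta> \<Longrightarrow> branch x \<beta> \<subseteq> branch x \<gamma>"
  by (rule played_antimono[OF played_branch])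

lemma branch_open: "\<beta> < depth x \<Longrightarrow> openin X (branch x \<beta>)"
  by (rule played_open(1)[OF played_branch])

lemma branch_agree:
  assumes y: "y \<in> topspace X" and b: "\<beta> < depth y" and x: "x \<in> branch y \<beta>"
  shows "\<beta> < depth x" "\<And>\<gamma>. \<gamma> \<le> \<beta> \<Longrightarrow> branch x \<gamma> = branch y \<gamma>"
proof -
  \<comment> \<open>\<open>branch_unique\<close> speaks of the moves strictly before its bound. To
    include inning \<beta> it is applied to the next one, which is still played since
    \<open>depth y\<close> is a limit.\<close>
  obtain \<delta> where d: "next_inning \<beta> \<delta>" "\<delta> < depth y"
    using limit_inning_between[OF depth_limit[OF y] b] by blast
  then have bd: "\<beta> < \<delta>" and le: "\<And>\<gamma>. \<gamma> < \<delta> \<Longrightarrow> \<gamma> \<le> \<beta>" by (simp_all add: next_inning_def)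
  have pl: "played X \<delta> (reply y) (branch y)"
    using played_mono[OF played_branch] d(2) by (meson less_imp_le)
  have mem: "x \<in> branch y \<gamma>" if "\<gamma> < \<delta>" for \<gamma>
    using branch_antimono[OF b le[OF that]] x by blast
  show "\<beta> < depth x" using branch_unique(1)[OF pl mem] bd by (rule order.strict_trans2[rotated])
  show "branch x \<gamma> = branch y \<gamma>" if "\<gamma> \<le> \<beta>" for \<gamma>
    using branch_unique(2)[OF pl mem, of \<gamma>] that bd by (meson order.strict_trans1)
qed

section \<open>The tree of Bob's moves\<close>

definition zero :: "'a inning" where "zero = (LEAST \<alpha>. True)"

lemma zero_le: "zero \<le> \<alpha>"
  unfolding zero_def by (rule Least_le) simp

lemma zero_less_depth: "x \<in> topspace X \<Longrightarrow> zero < depth x"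
  using limit_inning_nonempty[OF depth_limit] zero_le by (meson order.strict_trans1)

text \<open>If Alice's first partition is not trivial, the pieces of inning \<open>zero\<close> have no common node below
  them, so a root has to be added.  If it is trivial, the root coincides with the only piece.\<close>

definition root :: "'a set \<times> 'a inning" where "root = (topspace X, zero)"

definition nodes :: "('a set \<times> 'a inning) set" where
  "nodes = insert root {(branch x \<beta>, \<beta>) |x \<beta>. x \<in> topspace X \<and> \<beta> < depth x}"

text \<open>The innings separate copies of a set repeated by trivial partitions; inclusion places
  the root below the pieces of its own inning.\<close>

definition node_le :: "('a set \<times> 'a inning) rel" where
  "node_le = {(s, t). s \<in> nodes \<and> t \<in> nodes \<and> snd s \<le> snd t \<and> fst t \<subseteq> fst s}"

definition ray :: "'a \<Rightarrow> ('a set \<times> 'a inning) set" where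
  "ray x = {t \<in> nodes. x \<in> fst t}"

lemma branch_node: "x \<in> topspace X \<Longrightarrow> \<beta> < depth x \<Longrightarrow> (branch x \<beta>, \<beta>) \<in> nodes"
  by (auto simp: nodes_def)

lemma node_open: "t \<in> nodes \<Longrightarrow> openin X (fst t)"
  using branch_open by (auto simp: nodes_def root_def)

lemma node_nonempty:
  assumes "t \<in> nodes"
  shows "\<exists>x\<in>topspace X. x \<in> fst t"
proof (cases "t = root")
  case True
  then show ?thesis using nonempty by (simp add: root_def ex_in_conv)
next
  case False
  then obtain x \<beta> where "t = (branch x \<beta>, \<beta>)" "x \<in> topspace X" "\<beta> < depth x"
    using assms by (auto simp: nodes_def)
  then show ?thesis using mem_branch by (intro bexI[of _ x]) simp_all
qed

lemma ray_cases:
  assumes "t \<in> ray x" "x \<in> topspace X"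
  shows "snd t < depth x" "t = root \<or> t = (branch x (snd t), snd t)"
proof -
  have t: "t \<in> nodes" "x \<in> fst t" using assms by (auto simp: ray_def)
  have "snd t < depth x \<and> (t = root \<or> t = (branch x (snd t), snd t))"
  proof (cases "t = root")
    case True
    then show ?thesis using zero_less_depth assms by (simp add: root_def)
  next
    case False
    then obtain y \<beta> where y: "t = (branch y \<beta>, \<beta>)" "y \<in> topspace X" "\<beta> < depth y"
      using t(1) by (auto simp: nodes_def)
    then show ?thesis using branch_agree[OF y(2,3), of x] t(2) by simp
  qed
  then show "snd t < depth x" "t = root \<or> t = (branch x (snd t), snd t)" by blast+
qed

lemma root_in_ray: "x \<in> topspace X \<Longrightarrow> root \<in> ray x"
  by (auto simp: ray_def nodes_def root_def)

lemma branch_in_ray: "x \<in> topspace X \<Longrightarrow> \<beta> < depth x \<Longrightarrow> (branch x \<beta>, \<beta>) \<in> ray x"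
  by (simp add: ray_def branch_node mem_branch)

lemma root_least: "t \<in> nodes \<Longrightarrow> (root, t) \<in> node_le"
  using node_open[of t] zero_le openin_subset
  by (auto simp: node_le_def nodes_def root_def)

lemma ray_comparable:
  assumes x: "x \<in> topspace X" and s: "s \<in> ray x" and t: "t \<in> ray x" and le: "snd s \<le> snd t"
  shows "(s, t) \<in> node_le \<or> (t, s) \<in> node_le"
proof -
  have n: "s \<in> nodes" "t \<in> nodes" using s t by (auto simp: ray_def)
  show ?thesis
  proof (cases "s = root \<or> t = root")
    case True
    then show ?thesis using root_least n by blast
  next
    case False
    then have "fst s = branch x (snd s)" "fst t = branch x (snd t)"
      using ray_cases[OF s x] ray_cases[OF t x] by (metis fst_conv)+
    then have "fst t \<subseteq> fst s" using branch_antimono[OF ray_cases(1)[OF t x] le] by simp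
    then show ?thesis using n le by (auto simp: node_le_def)
  qed
qed

lemma ray_chain:
  assumes x: "x \<in> topspace X" and s: "s \<in> ray x" and t: "t \<in> ray x"
  shows "(s, t) \<in> node_le \<or> (t, s) \<in> node_le"
  using ray_comparable[OF x s t] ray_comparable[OF x t s] linear[of "snd s" "snd t"] by blast

lemma node_le_antisym: "(s, t) \<in> node_le \<Longrightarrow> (t, s) \<in> node_le \<Longrightarrow> s = t"
  by (auto simp: node_le_def intro!: prod_eqI)

lemma node_le_trans: "(s, t) \<in> node_le \<Longrightarrow> (t, u) \<in> node_le \<Longrightarrow> (s, u) \<in> node_le"
  by (auto simp: node_le_def)

lemma ray_strict:
  assumes x: "x \<in> topspace X" and "s \<in> ray x" "t \<in> ray x" and st: "(s, t) \<in> node_le" "s \<noteq> t"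
  shows "snd s < snd t \<or> snd s = snd t \<and> s = root \<and> t \<noteq> root"
proof (cases "snd s < snd t")
  case False
  then have eq: "snd s = snd t" using st(1) by (auto simp: node_le_def)
  have "t \<noteq> root"
    using st root_least[of s] node_le_antisym[of s t] by (auto simp: node_le_def)
  moreover have "s = root"
    using ray_cases(2)[OF \<open>s \<in> ray x\<close> x] ray_cases(2)[OF \<open>t \<in> ray x\<close> x] eq st(2) calculation by metis
  ultimately show ?thesis using eq by blast
qed simp

lemma tree_nodes: "tree_on nodes node_le"
  unfolding tree_on_def
proof (intro conjI ballI)
  show "partial_order_on nodes node_le"
    unfolding partial_order_on_def preorder_on_def
  proof (intro conjI)
    show "node_le \<subseteq> nodes \<times> nodes" by (auto simp: node_le_def)
    show "refl_on nodes node_le" by (auto simp: node_le_def refl_on_def)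
    show "trans node_le" using node_le_trans by (rule transI)
    show "antisym node_le" using node_le_antisym by (rule antisymI)
  qed
  show "\<exists>root\<in>nodes. \<forall>t\<in>nodes. (root, t) \<in> node_le"
    using root_least by (intro bexI[of _ root]) (auto simp: nodes_def)
next
  fix t assume t: "t \<in> nodes"
  obtain x where x: "x \<in> topspace X" "x \<in> fst t" using node_nonempty[OF t] by blast
  let ?A = "under node_le t"
  \<comment> \<open>All predecessors of \<open>t\<close> contain the point \<open>x\<close>, so they
    lie on its ray, where any two nodes are comparable.\<close>
  have sub: "?A \<subseteq> ray x" using x(2) by (auto simp: under_def node_le_def ray_def)
  have "wf (Restr node_le ?A - Id)"
  proof (rule wf_subset)
    \<comment> \<open>Along a ray the inning strictly increases, except possibly from the root to
      the first move; the second component breaks this tie.\<close>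
    show "wf (inv_image ({(\<alpha> :: 'a inning, \<beta>). \<alpha> < \<beta>} <*lex*> less_than)
        (\<lambda>s. (snd s, if s = root then 0 else 1 :: nat)))"
      by (intro wf_inv_image wf_lex_prod wf wf_less_than)
    show "Restr node_le ?A - Id \<subseteq> inv_image ({(\<alpha> :: 'a inning, \<beta>). \<alpha> < \<beta>} <*lex*> less_than)
        (\<lambda>s. (snd s, if s = root then 0 else 1 :: nat))"
    proof
      fix p assume "p \<in> Restr node_le ?A - Id"
      then obtain s u where p: "p = (s, u)" "(s, u) \<in> node_le" "s \<noteq> u" "s \<in> ?A" "u \<in> ?A" by auto
      then have "snd s < snd u \<or> snd s = snd u \<and> s = root \<and> u \<noteq> root"
        using ray_strict[OF x(1)] sub by blast
      then show "p \<in> inv_image ({(\<alpha> :: 'a inning, \<beta>). \<alpha> < \<beta>} <*lex*> less_than)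
          (\<lambda>s. (snd s, if s = root then 0 else 1 :: nat))"
        using p(1) by auto
    qed
  qed
  moreover have "linear_order_on ?A (Restr node_le ?A)"
    unfolding linear_order_on_def partial_order_on_def preorder_on_def
  proof (intro conjI)
    show "Restr node_le ?A \<subseteq> ?A \<times> ?A" by blast
    show "refl_on ?A (Restr node_le ?A)" by (auto simp: refl_on_def under_def node_le_def)
    show "trans (Restr node_le ?A)" using node_le_trans by (auto intro!: transI)
    show "antisym (Restr node_le ?A)" using node_le_antisym by (auto intro!: antisymI)
    show "total_on ?A (Restr node_le ?A)"
      using ray_chain[OF x(1)] sub unfolding total_on_def by blast
  qed
  ultimately show "well_order_on ?A (Restr node_le ?A)" by (simp add: well_order_on_def)
qed

section \<open>Points correspond to rays\<close>

lemma ray_in_rays: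
  assumes x: "x \<in> topspace X"
  shows "ray x \<in> rays nodes node_le"
  unfolding rays_def
proof (intro CollectI conjI ballI impI)
  show "ray x \<noteq> {}" using root_in_ray[OF x] by blast
  show "ray x \<subseteq> nodes" by (auto simp: ray_def)
  show "ray x \<in> Chains node_le" using ray_chain[OF x] by (auto simp: Chains_def)
  show "s \<in> ray x" if "t \<in> ray x" "(s, t) \<in> node_le" for s t
    using that by (auto simp: ray_def node_le_def)
  show "\<not> (\<exists>m\<in>ray x. \<forall>t\<in>ray x. (m, t) \<in> node_le \<longrightarrow> t = m)"
  proof
    assume "\<exists>m\<in>ray x. \<forall>t\<in>ray x. (m, t) \<in> node_le \<longrightarrow> t = m"
    then obtain m where m: "m \<in> ray x" "\<And>t. t \<in> ray x \<Longrightarrow> (m, t) \<in> node_le \<Longrightarrow> t = m" by blast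
    \<comment> \<open>Since \<open>depth x\<close> is a limit, the run of \<open>x\<close> continues
      after the inning of \<open>m\<close>, and its next move is a node that cannot lie below
      \<open>m\<close>.\<close>
    obtain \<gamma> where g: "next_inning (snd m) \<gamma>" "\<gamma> < depth x"
      using limit_inning_between[OF depth_limit[OF x] ray_cases(1)[OF m(1) x]] by blast
    then have lt: "snd m < \<gamma>" by (simp add: next_inning_def)
    have t: "(branch x \<gamma>, \<gamma>) \<in> ray x" using branch_in_ray[OF x g(2)] .
    then have ne: "(m, (branch x \<gamma>, \<gamma>)) \<notin> node_le" using m(2)[OF t] lt by auto
    then have "((branch x \<gamma>, \<gamma>), m) \<in> node_le" using ray_chain[OF x m(1) t] by blast
    then have "\<gamma> \<le> snd m" by (simp add: node_le_def)
    then show False using lt by (meson not_le)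
  qed
qed

text \<open>The ray determines Bob's moves and the length of the run, hence Alice's last answer, and
  that answer names the discarded point.\<close>

lemma inj_ray: "inj_on ray (topspace X)"
proof (rule inj_onI)
  fix x y assume x: "x \<in> topspace X" and y: "y \<in> topspace X" and eq: "ray x = ray y"
  have "depth x \<le> depth y" if "x \<in> topspace X" "y \<in> topspace X" "ray x = ray y" for x y
  proof (rule ccontr)
    assume "\<not> ?thesis"
    then have "depth y < depth x" by simp
    then have "(branch x (depth y), depth y) \<in> ray y"
      using branch_in_ray[OF that(1)] that(3) by blast
    then show False using ray_cases(1)[OF _ that(2)] by fastforce
  qed
  then have d: "depth x = depth y" using x y eq by (metis antisym)
  have "y \<in> branch x \<beta>" if "\<beta> < depth x" for \<beta>
  proof -
    have "(branch x \<beta>, \<beta>) \<in> ray y" using branch_in_ray[OF x that] eq by simp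
    then show ?thesis by (simp add: ray_def)
  qed
  then have "reply y (depth x) = reply x (depth x)" by (rule branch_unique(3)[OF played_branch])
  moreover obtain P where "reply x (depth x) = Limit P x" using depth_reply[OF x] by blast
  moreover obtain Q where "reply y (depth y) = Limit Q y" using depth_reply[OF y] by blast
  ultimately have "Limit P x = Limit Q y" by (metis d)
  then show "x = y" by simp
qed

text \<open>Comparable sets share a point, and a shared point forces the two runs to coincide up to
  that inning.\<close>

lemma node_unique:
  assumes "x \<in> topspace X" "y \<in> topspace X" "\<beta> < depth x" "\<beta> < depth y"
    and "((branch x \<beta>, \<beta>), (branch y \<beta>, \<beta>)) \<in> node_le \<or> ((branch y \<beta>, \<beta>), (branch x \<beta>, \<beta>)) \<in> node_le"
  shows "branch x \<beta> = branch y \<beta>"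
proof -
  have "y \<in> branch x \<beta> \<or> x \<in> branch y \<beta>"
    using assms(5) mem_branch[OF assms(3)] mem_branch[OF assms(4)] by (auto simp: node_le_def)
  then show ?thesis
    using branch_agree(2)[OF assms(1,3) _ order.refl] branch_agree(2)[OF assms(2,4) _ order.refl] by metis
qed

text \<open>The nodes of \<open>R\<close> are assembled into one run. The absence of a maximal node
  makes its length a limit, and the preimage of \<open>R\<close> is the point that \<sigma> discards
  there.\<close>

lemma surj_ray:
  assumes R: "R \<in> rays nodes node_le"
  shows "R \<in> ray ` topspace X"
proof -
  have Rn: "R \<noteq> {}" "R \<subseteq> nodes"
    and chain: "\<And>s t. s \<in> R \<Longrightarrow> t \<in> R \<Longrightarrow> (s, t) \<in> node_le \<or> (t, s) \<in> node_le"
    and down: "\<And>s t. t \<in> R \<Longrightarrow> (s, t) \<in> node_le \<Longrightarrow> s \<in> R"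
    and nomax: "\<And>m. m \<in> R \<Longrightarrow> \<exists>t\<in>R. (m, t) \<in> node_le \<and> t \<noteq> m"
  proof -
    have le_nodes: "s \<in> nodes" if "(s, t) \<in> node_le" for s t using that by (auto simp: node_le_def)
    show "R \<noteq> {}" "R \<subseteq> nodes" using R unfolding rays_def by blast+
    show "(s, t) \<in> node_le \<or> (t, s) \<in> node_le" if "s \<in> R" "t \<in> R" for s t
      using R that unfolding rays_def Chains_def by blast
    show "s \<in> R" if "t \<in> R" "(s, t) \<in> node_le" for s t
      using R that le_nodes unfolding rays_def by blast
    show "\<exists>t\<in>R. (m, t) \<in> node_le \<and> t \<noteq> m" if "m \<in> R" for m
      using R that unfolding rays_def by blast
  qed
  \<comment> \<open>The innings in which \<open>R\<close> contains a move of Bob. The root counts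
    only if it coincides with such a move.\<close>
  define I where "I = {\<beta>. \<exists>x. x \<in> topspace X \<and> \<beta> < depth x \<and> (branch x \<beta>, \<beta>) \<in> R}"
  define p where "p \<beta> = (SOME x. x \<in> topspace X \<and> \<beta> < depth x \<and> (branch x \<beta>, \<beta>) \<in> R)" for \<beta>
  have p: "p \<beta> \<in> topspace X \<and> \<beta> < depth (p \<beta>) \<and> (branch (p \<beta>) \<beta>, \<beta>) \<in> R" if "\<beta> \<in> I" for \<beta>
    using that unfolding p_def I_def mem_Collect_eq by (rule someI_ex)
  define U where "U \<beta> = branch (p \<beta>) \<beta>" for \<beta>
  have uniq: "\<beta> \<in> I \<and> branch x \<beta> = U \<beta>" if "x \<in> topspace X" "\<beta> < depth x" "(branch x \<beta>, \<beta>) \<in> R" for x \<beta>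
  proof -
    have "\<beta> \<in> I" using that by (auto simp: I_def)
    then show ?thesis
      unfolding U_def using node_unique[OF that(1) _ that(2)] p chain[OF that(3)] by blast
  qed
  have lower: "\<gamma> \<in> I \<and> U \<gamma> = branch (p \<beta>) \<gamma>" if b: "\<beta> \<in> I" and g: "\<gamma> \<le> \<beta>" for \<beta> \<gamma>
  proof -
    have q: "p \<beta> \<in> topspace X" "\<beta> < depth (p \<beta>)" "(branch (p \<beta>) \<beta>, \<beta>) \<in> R" using p[OF b] by blast+
    have g': "\<gamma> < depth (p \<beta>)" using g q(2) by (rule order.strict_trans1)
    have "((branch (p \<beta>) \<gamma>, \<gamma>), (branch (p \<beta>) \<beta>, \<beta>)) \<in> node_le"
      using branch_antimono[OF q(2) g] branch_node[OF q(1)] q(2) g g' by (simp add: node_le_def)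
    then have "(branch (p \<beta>) \<gamma>, \<gamma>) \<in> R" using down[OF q(3)] by blast
    then show ?thesis using uniq[OF q(1) g'] by simp
  qed
  \<comment> \<open>Up to each inning \<beta> in \<open>I\<close>, the sequence \<open>U\<close>
    agrees with the genuine run of the point \<open>p \<beta>\<close>; legality is checked inning by
    inning and carries over.\<close>
  have played: "played X \<alpha> (answers \<sigma> U) U" if "{..<\<alpha>} \<subseteq> I" for \<alpha>
    unfolding played_def
  proof (intro allI impI)
    fix \<beta> assume "\<beta> < \<alpha>"
    then have b: "\<beta> \<in> I" using that by blast
    have eq: "U \<gamma> = branch (p \<beta>) \<gamma>" if "\<gamma> \<le> \<beta>" for \<gamma> using lower[OF b that] by blast
    then have "answers \<sigma> U \<beta> = reply (p \<beta>) \<beta>"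
      by (intro answers_cong) (meson less_imp_le)
    moreover have "legal X \<beta> U m \<longleftrightarrow> legal X \<beta> (branch (p \<beta>)) m" for m
      using eq by (intro legal_cong) (meson less_imp_le)
    moreover have "legal X \<beta> (branch (p \<beta>)) (reply (p \<beta>) \<beta>) \<and> branch (p \<beta>) \<beta> \<in> pieces (reply (p \<beta>) \<beta>)"
      using played_branch[of "p \<beta>"] p[OF b] by (simp add: played_def)
    ultimately show "legal X \<beta> U (answers \<sigma> U \<beta>) \<and> U \<beta> \<in> pieces (answers \<sigma> U \<beta>)"
      using eq[OF order.refl] by simp
  qed
  have "\<exists>\<beta>. \<beta> \<notin> I"
  proof (rule ccontr)
    assume "\<not> ?thesis"
    then have "played X \<alpha> (answers \<sigma> U) U" for \<alpha> by (intro played) blast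
    then show False using every_run_ends by blast
  qed
  define \<alpha> where "\<alpha> = (LEAST \<beta>. \<beta> \<notin> I)"
  have "\<alpha> \<notin> I" unfolding \<alpha>_def using \<open>\<exists>\<beta>. \<beta> \<notin> I\<close> by (rule LeastI_ex)
  have I: "\<beta> \<in> I \<longleftrightarrow> \<beta> < \<alpha>" for \<beta>
  proof
    assume "\<beta> \<in> I"
    then show "\<beta> < \<alpha>" using lower[of \<beta> \<alpha>] \<open>\<alpha> \<notin> I\<close> by (meson not_le)
  next
    assume "\<beta> < \<alpha>"
    then show "\<beta> \<in> I" unfolding \<alpha>_def using not_less_Least by blast
  qed
  have above: "\<exists>x \<gamma>. x \<in> topspace X \<and> \<gamma> < depth x \<and> t = (branch x \<gamma>, \<gamma>) \<and> \<gamma> \<in> I"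
    if t: "t \<in> R" and nr: "t \<noteq> root" for t
  proof -
    have "t \<in> nodes" using t Rn(2) by blast
    then obtain x \<gamma> where "x \<in> topspace X" "\<gamma> < depth x" "t = (branch x \<gamma>, \<gamma>)"
      using nr unfolding nodes_def by blast
    then show ?thesis using t uniq by blast
  qed
  \<comment> \<open>A node strictly above another is not the root, so it is a move of Bob with its
    inning in \<open>I\<close>. In this way the absence of a maximal node speaks about
    innings.\<close>
  have beyond_root: "t \<noteq> root" if "(m, t) \<in> node_le" "t \<noteq> m" for m t
    using that root_least[of m] node_le_antisym[of m t] by (auto simp: node_le_def)
  have succ: "\<exists>\<gamma><\<alpha>. \<beta> < \<gamma>" if b: "\<beta> < \<alpha>" for \<beta>
  proof -
    have bI: "\<beta> \<in> I" using b I by blast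
    then obtain t where t: "t \<in> R" "((U \<beta>, \<beta>), t) \<in> node_le" "t \<noteq> (U \<beta>, \<beta>)"
      using nomax[of "(U \<beta>, \<beta>)"] p unfolding U_def by blast
    then obtain x \<gamma> where x: "x \<in> topspace X" "\<gamma> < depth x" "t = (branch x \<gamma>, \<gamma>)" "\<gamma> \<in> I"
      using above beyond_root by blast
    have "t = (U \<gamma>, \<gamma>)" using uniq[OF x(1,2)] t(1) x(3) by simp
    then have "\<beta> \<noteq> \<gamma>" using t(3) by blast
    moreover have "\<beta> \<le> \<gamma>" using t(2) x(3) by (simp add: node_le_def)
    ultimately have "\<beta> < \<gamma>" by simp
    then show ?thesis using x(4) I by blast
  qed
  have lim: "limit_inning \<alpha>"
    unfolding limit_inning_def
  proof (intro conjI notI)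
    obtain m where m: "m \<in> R" using Rn by blast
    then obtain t where "t \<in> R" "(m, t) \<in> node_le" "t \<noteq> m" using nomax by blast
    then obtain \<beta> where "\<beta> < \<alpha>" using above[of t] beyond_root[of m t] I by blast
    moreover assume "first_inning \<alpha>"
    ultimately show False using not_less_first_inning by blast
  next
    assume "\<exists>\<beta>. next_inning \<beta> \<alpha>"
    then show False using succ unfolding next_inning_def by (meson not_le)
  qed
  have pl: "played X \<alpha> (answers \<sigma> U) U" using I by (intro played) auto
  have l: "legal X \<alpha> U (answers \<sigma> U \<alpha>)" using answer_legal[OF pl] .
  then obtain P z where z: "answers \<sigma> U \<alpha> = Limit P z"
    using lim legal_Partition[OF pl] by (cases "answers \<sigma> U \<alpha>") auto
  have z': "z \<in> topspace X" "z \<in> position X U \<alpha>" "z \<notin> \<Union>P"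
    using l unfolding z legal_Limit[OF pl] by blast+
  have mem: "z \<in> U \<beta>" if "\<beta> < \<alpha>" for \<beta> using z'(2) that by (auto simp: position_def)
  have zU: "branch z \<beta> = U \<beta>" if "\<beta> < \<alpha>" for \<beta> using branch_unique(2)[OF pl mem that] .
  \<comment> \<open>The moves in \<open>U\<close> all contain \<open>z\<close>, so its run lasts at
    least until \<alpha>; there Alice discards it, so it lasts no longer.\<close>
  have "depth z \<le> \<alpha>" using depth_le branch_unique(3)[OF pl mem] z z'(3) by auto
  then have d: "depth z = \<alpha>" using branch_unique(1)[OF pl mem] by (rule antisym)
  have "ray z = R"
  proof (intro equalityI subsetI)
    fix t assume t: "t \<in> ray z"
    show "t \<in> R"
    proof (cases "t = root")
      case True
      obtain m where "m \<in> R" using Rn by blast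
      then show ?thesis using True down root_least Rn by blast
    next
      case False
      then have "t = (U (snd t), snd t)" "snd t < \<alpha>"
        using ray_cases[OF t z'(1)] d zU by auto
      then show ?thesis using p I unfolding U_def by metis
    qed
  next
    fix t assume t: "t \<in> R"
    show "t \<in> ray z"
    proof (cases "t = root")
      case True
      then show ?thesis using root_in_ray z'(1) by simp
    next
      case False
      then obtain x \<gamma> where x: "x \<in> topspace X" "\<gamma> < depth x" "t = (branch x \<gamma>, \<gamma>)" "\<gamma> \<in> I"
        using above t by blast
      then have "t = (branch z \<gamma>, \<gamma>)" "\<gamma> < depth z"
        using uniq[OF x(1,2)] t zU I d by auto
      then show ?thesis using branch_in_ray z'(1) by simp
    qed
  qed
  then show ?thesis using z'(1) by blast
qed

section \<open>Comparison of the two topologies\<close>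

lemma depth_Limit:
  assumes x: "x \<in> topspace X"
  obtains P where "reply x (depth x) = Limit P x"
    "local_basis X x {branch x \<beta> - \<Union>\<F> |\<beta> \<F>. \<beta> < depth x \<and> \<F> \<subseteq> P \<and> finite \<F>}"
    "x \<notin> \<Union>P" "\<forall>Q\<in>P. (Q, depth x) \<in> nodes"
proof -
  obtain P where P: "reply x (depth x) = Limit P x" using depth_reply[OF x] by blast
  have l: "legal X (depth x) (branch x) (Limit P x)"
    using answer_legal[OF played_branch, of x] P by simp
  note l' = l[unfolded legal_Limit[OF played_branch]]
  \<comment> \<open>The pieces offered beside \<open>x\<close> are not on its ray, but they are
    nodes: the run of any \<open>y\<close> in \<open>Q\<close> agrees with that of \<open>x\<close>
    so far and then picks \<open>Q\<close>.\<close>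
  have "(Q, depth x) \<in> nodes" if Q: "Q \<in> P" for Q
  proof -
    obtain y where y: "y \<in> Q" using l' Q by blast
    then have ypos: "y \<in> position X (branch x) (depth x)" using l' Q by blast
    then have yt: "y \<in> topspace X" and mem: "\<And>\<beta>. \<beta> < depth x \<Longrightarrow> y \<in> branch x \<beta>"
      by (auto simp: position_def)
    have rep: "reply y (depth x) = Limit P x" using branch_unique(3)[OF played_branch mem] P by simp
    then have "depth y \<noteq> depth x" using depth_not[of y] Q y by auto
    then have d: "depth x < depth y" using branch_unique(1)[OF played_branch mem] by simp
    have "legal X (depth x) (branch y) (Limit P x)" "branch y (depth x) \<in> P"
      using played_branch[of y] d rep by (auto simp: played_def)
    then have "branch y (depth x) = Q"
      using disjoint_pieces[of X "depth x" "branch y" "Limit P x" "branch y (depth x)" Q y] mem_branch[OF d] Q y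
      by simp
    then show ?thesis using branch_node[OF yt d] by simp
  qed
  then have "\<forall>Q\<in>P. (Q, depth x) \<in> nodes" by blast
  with P l' show ?thesis by (intro that) blast+
qed

text \<open>For \<open>y\<close> outside a move, consider the first inning in which the run leaves
  \<open>y\<close> behind. Either another piece of that inning contains \<open>y\<close>, or
  \<open>y\<close> is discarded there, and then the local basis at \<open>y\<close> contains a set
  from which just the chosen piece was removed.\<close>

lemma node_closed:
  assumes "t \<in> nodes"
  shows "openin X (topspace X - fst t)"
proof (cases "t = root")
  case False
  then obtain x \<beta> where x: "x \<in> topspace X" "\<beta> < depth x" "t = (branch x \<beta>, \<beta>)"
    using assms by (auto simp: nodes_def)
  have "\<exists>V. openin X V \<and> y \<in> V \<and> V \<subseteq> topspace X - branch x \<beta>"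
    if y: "y \<in> topspace X" "y \<notin> branch x \<beta>" for y
  proof -
    define \<gamma> where "\<gamma> = (LEAST \<gamma>. y \<notin> branch x \<gamma>)"
    have g: "y \<notin> branch x \<gamma>" "\<gamma> \<le> \<beta>"
      unfolding \<gamma>_def using y(2) by (rule LeastI Least_le)+
    have mem: "y \<in> branch x \<delta>" if "\<delta> < \<gamma>" for \<delta>
      using that not_less_Least unfolding \<gamma>_def by blast
    have gx: "\<gamma> < depth x" using g(2) x(2) by (rule order.strict_trans1)
    have pl: "played X \<gamma> (reply x) (branch x)"
      using played_mono[OF played_branch] gx by (meson less_imp_le)
    have rep: "reply y \<gamma> = reply x \<gamma>" using branch_unique(3)[OF pl mem] .
    have l: "legal X \<gamma> (branch x) (reply x \<gamma>)" "branch x \<gamma> \<in> pieces (reply x \<gamma>)"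
      using played_branch[of x] gx by (auto simp: played_def)
    have sub: "branch x \<beta> \<subseteq> branch x \<gamma>" using branch_antimono[OF x(2) g(2)] .
    show ?thesis
    proof (cases "\<gamma> < depth y")
      case True
      then have "branch y \<gamma> \<in> pieces (reply x \<gamma>)"
        using played_branch[of y] rep by (auto simp: played_def)
      then have "branch y \<gamma> \<inter> branch x \<gamma> = {}"
        using disjoint_pieces[OF l(1) _ l(2)] g(1) mem_branch[OF True] by blast
      then show ?thesis
        using branch_open[OF True] mem_branch[OF True] sub openin_subset by blast
    next
      case False
      then have d: "depth y = \<gamma>" using branch_unique(1)[OF pl mem] False by simp
      obtain P where P: "reply y (depth y) = Limit P y"
        "local_basis X y {branch y \<beta> - \<Union>\<F> |\<beta> \<F>. \<beta> < depth y \<and> \<F> \<subseteq> P \<and> finite \<F>}"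
        by (rule depth_Limit[OF y(1)])
      obtain \<delta> where "\<delta> < depth y" using zero_less_depth[OF y(1)] by blast
      moreover have "branch x \<gamma> \<in> P" using P(1) rep l(2) d by simp
      ultimately have "branch y \<delta> - \<Union>{branch x \<gamma>} \<in>
          {branch y \<beta> - \<Union>\<F> |\<beta> \<F>. \<beta> < depth y \<and> \<F> \<subseteq> P \<and> finite \<F>}" by blast
      then have "openin X (branch y \<delta> - \<Union>{branch x \<gamma>}) \<and> y \<in> branch y \<delta> - \<Union>{branch x \<gamma>}"
        by (rule bspec[OF conjunct1[OF P(2)[unfolded local_basis_def]]])
      moreover have "branch y \<delta> - \<Union>{branch x \<gamma>} \<subseteq> topspace X - branch x \<beta>"
        using calculation sub openin_subset by fast
      ultimately show ?thesis by blast
    qed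
  qed
  then show ?thesis using x(3) by (subst openin_subopen) auto
qed (simp add: root_def)

lemma openin_agreement:
  assumes "finite F" "F \<subseteq> nodes" "x \<in> topspace X"
  shows "openin X {y \<in> topspace X. \<forall>t\<in>F. t \<in> ray y \<longleftrightarrow> t \<in> ray x}"
  using assms(1,2)
proof (induction F)
  case (insert t F)
  have "t \<in> nodes" using insert.prems by blast
  then have "{y \<in> topspace X. t \<in> ray y} = fst t" "{y \<in> topspace X. t \<notin> ray y} = topspace X - fst t"
    using openin_subset[OF node_open, of t] by (auto simp: ray_def)
  then have "openin X {y \<in> topspace X. t \<in> ray y}" "openin X {y \<in> topspace X. t \<notin> ray y}"
    using node_open node_closed \<open>t \<in> nodes\<close> by auto
  then have "openin X {y \<in> topspace X. t \<in> ray y \<longleftrightarrow> t \<in> ray x}"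
    by (cases "t \<in> ray x") simp_all
  then have "openin X ({y \<in> topspace X. t \<in> ray y \<longleftrightarrow> t \<in> ray x} \<inter>
      {y \<in> topspace X. \<forall>t\<in>F. t \<in> ray y \<longleftrightarrow> t \<in> ray x})"
    using insert by (intro openin_Int) auto
  moreover have "{y \<in> topspace X. t \<in> ray y \<longleftrightarrow> t \<in> ray x} \<inter>
      {y \<in> topspace X. \<forall>t\<in>F. t \<in> ray y \<longleftrightarrow> t \<in> ray x} =
      {y \<in> topspace X. \<forall>t\<in>insert t F. t \<in> ray y \<longleftrightarrow> t \<in> ray x}" by blast
  ultimately show ?case by simp
qed simp

lemma ray_coding_ray: "ray_coding X nodes node_le ray"
  unfolding ray_coding_def
proof (intro conjI allI impI)
  show "tree_on nodes node_le" by (rule tree_nodes)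
  show "bij_betw ray (topspace X) (rays nodes node_le)"
    using inj_ray ray_in_rays surj_ray by (auto simp: bij_betw_def)
next
  fix W assume W: "W \<subseteq> topspace X"
  show "openin X W \<longleftrightarrow> (\<forall>x\<in>W. \<exists>F. finite F \<and> F \<subseteq> nodes \<and>
      {y \<in> topspace X. \<forall>t\<in>F. t \<in> ray y \<longleftrightarrow> t \<in> ray x} \<subseteq> W)" (is "_ \<longleftrightarrow> ?r")
  proof
    assume o: "openin X W"
    show ?r
    proof
      fix x assume xW: "x \<in> W"
      then have x: "x \<in> topspace X" using W by blast
      obtain P where P: "reply x (depth x) = Limit P x"
        "local_basis X x {branch x \<beta> - \<Union>\<F> |\<beta> \<F>. \<beta> < depth x \<and> \<F> \<subseteq> P \<and> finite \<F>}"
        "x \<notin> \<Union>P" "\<forall>Q\<in>P. (Q, depth x) \<in> nodes"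
        by (rule depth_Limit[OF x])
      have "\<exists>B\<in>{branch x \<beta> - \<Union>\<F> |\<beta> \<F>. \<beta> < depth x \<and> \<F> \<subseteq> P \<and> finite \<F>}. B \<subseteq> W"
        using conjunct2[OF P(2)[unfolded local_basis_def]] o xW by simp
      then obtain \<beta> \<F> where B: "\<beta> < depth x" "\<F> \<subseteq> P" "finite \<F>" "branch x \<beta> - \<Union>\<F> \<subseteq> W"
        by blast
      \<comment> \<open>Translates the basic neighbourhood into nodes: agreement with
        \<open>x\<close> at the first node forces membership in \<open>branch x \<beta>\<close>, and
        at the others, whose sets omit \<open>x\<close>, it excludes the removed pieces.\<close>
      let ?F = "insert (branch x \<beta>, \<beta>) ((\<lambda>Q. (Q, depth x)) ` \<F>)"
      have "?F \<subseteq> nodes" using branch_node[OF x B(1)] P(4) B(2) by blast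
      moreover have "{y \<in> topspace X. \<forall>t\<in>?F. t \<in> ray y \<longleftrightarrow> t \<in> ray x} \<subseteq> W"
      proof
        fix y assume y: "y \<in> {y \<in> topspace X. \<forall>t\<in>?F. t \<in> ray y \<longleftrightarrow> t \<in> ray x}"
        have "y \<in> branch x \<beta>"
          using y branch_in_ray[OF x B(1)] by (auto simp: ray_def)
        moreover have "y \<notin> Q" if "Q \<in> \<F>" for Q
        proof -
          have "(Q, depth x) \<in> nodes" "x \<notin> Q" using that B(2) P(3,4) by blast+
          then show ?thesis using y that by (auto simp: ray_def)
        qed
        ultimately show "y \<in> W" using B(4) by blast
      qed
      ultimately show "\<exists>F. finite F \<and> F \<subseteq> nodes \<and>
          {y \<in> topspace X. \<forall>t\<in>F. t \<in> ray y \<longleftrightarrow> t \<in> ray x} \<subseteq> W"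
        using B(3) by (intro exI[of _ ?F]) blast
    qed
  next
    assume r: ?r
    have "\<exists>V. openin X V \<and> x \<in> V \<and> V \<subseteq> W" if xW: "x \<in> W" for x
    proof -
      obtain F where F: "finite F" "F \<subseteq> nodes" "{y \<in> topspace X. \<forall>t\<in>F. t \<in> ray y \<longleftrightarrow> t \<in> ray x} \<subseteq> W"
        using bspec[OF r xW] by (elim exE conjE)
      have x: "x \<in> topspace X" using W xW by blast
      show ?thesis
      proof (intro exI conjI)
        show "openin X {y \<in> topspace X. \<forall>t\<in>F. t \<in> ray y \<longleftrightarrow> t \<in> ray x}"
          by (rule openin_agreement[OF F(1,2) x])
        show "x \<in> {y \<in> topspace X. \<forall>t\<in>F. t \<in> ray y \<longleftrightarrow> t \<in> ray x}" using x by simp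
      qed (rule F(3))
    qed
    then show "openin X W" by (subst openin_subopen) (rule ballI)
  qed
qed

end

text \<open>The second conjunct leaves the node type free. Together with the first it shows that the
  type fixed there captures every ray space.\<close>

theorem corollary3p16:
  fixes X :: "'a topology"
  assumes "topspace X \<noteq> {}"
  shows "(ray_space TYPE('a set \<times> 'a inning) X \<longleftrightarrow> (\<exists>\<sigma>. Alice_winning_strategy X \<sigma>)) \<and>
         (ray_space TYPE('b) X \<longrightarrow> (\<exists>\<sigma>. Alice_winning_strategy X \<sigma>))"
proof (intro conjI iffI impI)
  assume "ray_space TYPE('a set \<times> 'a inning) X"
  then obtain T :: "('a set \<times> 'a inning) set" and r f where "ray_coding X T r f"
    unfolding ray_space_iff_ray_coding by blast
  then show "\<exists>\<sigma>. Alice_winning_strategy X \<sigma>"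
    using ray_coded.winning_tree_strategy[OF ray_coded.intro] assms by blast
next
  assume "\<exists>\<sigma>. Alice_winning_strategy X \<sigma>"
  then obtain \<sigma> where "winning X \<sigma>" using assms by (auto simp: winning_def)
  then show "ray_space TYPE('a set \<times> 'a inning) X"
    using winning.ray_coding_ray ray_space_iff_ray_coding by blast
next
  assume "ray_space TYPE('b) X"
  then obtain T :: "'b set" and r f where "ray_coding X T r f"
    unfolding ray_space_iff_ray_coding by blast
  then show "\<exists>\<sigma>. Alice_winning_strategy X \<sigma>"
    using ray_coded.winning_tree_strategy[OF ray_coded.intro] assms by blast
qed

end
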